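(* Let $A\in\mathcal{A}_{n,1}$ and $\Omega=\Phi(\Lambda(A))$. Then $\overline{\Omega}=\Phi(\Lambda(\overline{A}))$, where $\overline{\Omega}$ is the dual of $\Omega$ (defined in the context).
   Context: An alternating sign matrix (ASM) of order $n$ is an $n\times n$ matrix $A=(a_{ij})$ with entries in $\{-1,0,1\}$ such that in every row and every column the nonzero entries alternate in sign, the first and the last nonzero entries being $1$. $\mathcal{A}_{n,1}$ denotes the set of order-$n$ ASMs having exactly one entry equal to $-1$. For an ASM $A=(a_{ij})$, $\overline{A}=(a_{i,n+1-j})$ is the vertical reflection of $A$. Let $A\in\mathcal{A}_{n,1}$. The opening column is the column containing the unique $-1$; the closing row is the row containing the $-1$; the opening row is the row of the $1$ of the opening column lying above the $-1$. The columns strictly to the left (resp. right) of the opening column form the left side (resp. right side). The closing row contains exactly two $1$'s, one in each side; the one in the right side is the closing $1$ and its column is the closing column. The rows strictly between the opening row and the closing row are the enclosed rows. $A$ is neutral if there are no enclosed rows; otherwise $A$ is positive if the $1$ of the lowest enclosed row lies in the right side, and negative if it lies in the left side. $\mathcal{A}_{n,1}^{+},\mathcal{A}_{n,1}^{0},\mathcal{A}_{n,1}^{-}$ denote the sets of positive, neutral, negative elements of $\mathcal{A}_{n,1}$; $A$ is negative iff $\overline{A}$ is positive. For $A\in\mathcal{A}_{n,1}^{+}\cup\mathcal{A}_{n,1}^{0}$: the charged cell is the intersection of the enclosed rows with the right side; the extended neutral cell is the intersection of the rows from the opening row to the closing row (inclusive) with the left side. The leading $1$ is the highest $1$ in the left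 side strictly below the opening row; its column is the leading column; the leading cell consists of the entries strictly below the opening row and strictly between the leading column and the opening column, and $\ell(A)$ is the sum of its entries. The closing cell consists of the entries strictly below the closing row and strictly between the opening column and the closing column, and $c(A)$ is the sum of its entries; the extended closing cell consists of the entries strictly below the closing row in the columns from the opening column to the closing column inclusive. If $A$ is positive, $E(A)$ is the sum of the entries of the charged cell; if $A$ is neutral, $E(A)=0$. Horizontal displacement: for an $m\times q$ $(0,1)$-matrix $P$ whose nonzero columns are $j_1<\dots<j_t$ with $j_1=1$ and $j_t<q$, $H(P)$ is the $m\times q$ matrix whose column $j_{s+1}$ equals column $j_s$ of $P$ for $1\le s\le t$ (where $j_{t+1}=q$), all other columns being zero. Vertical displacement: for an $m\times q$ $(0,1)$-matrix $P$ whose nonzero rows are $i_1<\dots<i_t$ with $i_1>1$ and $i_t=m$, $V(P)$ is the $m\times q$ matrix whose row $i_{s-1}$ equals row $i_s$ of $P$ for $1\le s\le t$ (where $i_0=1$), all other rows being zero. Partial discharging procedure: for $A\in\mathcal{A}_{n,1}^{+}\cup\mathcal{A}_{n,1}^{0}$, $\delta(A)$ is obtained by applying successively the following steps (all cells, rows and columns referring to the positions they occupy in $A$): (1) replace the $-1$ and the closing $1$ by $0$; (2) replace the submatrix occupying the extended closing cell by its image under $H$; (3) replace the submatrix occupying the extended neutral cell by its image under $V$; (4) lower the entries of the extended neutral cell and of the charged cell by one row: in the left side, for each row $t$ strictly below the opening row up to and including the closing row, the left part of row $t$ becomes the former left part of row $t-1$, and the left part of the opening row becomes zero; in the right side, for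 each row $t$ from two rows below the opening row up to and including the closing row, the right part of row $t$ becomes the former right part of row $t-1$, and the right part of the row immediately below the opening row becomes zero. The complete discharging procedure is $\Delta(A)=(k,\delta(A),c(A),E(A))$, where $k$ is the index of the opening row of $A$. It is known that $\Delta$ is injective on $\mathcal{A}_{n,1}^{+}\cup\mathcal{A}_{n,1}^{0}$, and that whenever $\Delta(A)=(k,P,c,E)$, there is a unique $N\in\mathcal{A}_{n,1}^{+}\cup\mathcal{A}_{n,1}^{0}$ with $\Delta(N)=(k,P,c+E,0)$, and this $N$ is neutral. Neutralizing procedure $\Lambda$: for $A\in\mathcal{A}_{n,1}^{+}\cup\mathcal{A}_{n,1}^{0}$ with $\Delta(A)=(k,P,c,E)$, $\Lambda(A)=(N,E)$ where $N$ is the unique element with $\Delta(N)=(k,P,c+E,0)$. For $A\in\mathcal{A}_{n,1}^{-}$, write $\Lambda(\overline{A})=(M,-E)$ and set $\Lambda(A)=(\overline{M},E)$. $\Lambda$ takes values in $\mathcal{N}_{n,1}=\{(N,E)\,:\,N\in\mathcal{A}_{n,1}^{0},\ E\in\mathbb{Z},\ -\ell(N)\le E\le c(N)\}$. Generalized inversion table: for $(N,E)\in\mathcal{N}_{n,1}$, let $n+1-k$ be the index of the opening row of $N$ (so the closing row is row $n+2-k$). For $1\le i\le n$, $a_i$ is the sum of the entries of $N$ lying strictly below row $n+1-i$ and strictly to the left of the unique $1$ of row $n+1-i$ (for $i=k-1$, i.e. the closing row, the leftmost $1$ of that row is used). Let $b=c(N)$ and $\beta=E+\ell(N)$. The generalized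 inversion table of $(N,E)$ is $(k;a_1,\dots,a_n;b,\beta)$. Mixed configurations: let $\mathcal{G}_n=\{(x,y)\in\mathbb{Z}^2: 0\le x<y\le n\}$. Steps are $E=(1,0)$, $F=(1,0)$ (a distinct letter from $E$ with the same displacement), $S=(0,-1)$, $N=(1,1)$. A mixed path is a lattice path all of whose vertices lie in $\mathcal{G}_n$, given as a word $LR$ where the Left part $L$ is a word in $\{S,E\}$ and the Right part $R$ is a word in $\{F,N\}$; the vertex where $L$ ends and $R$ begins is the junction. An order-$n$ mixed configuration is a sequence $(\omega_1,\dots,\omega_n)$ of mixed paths such that for some permutation $\sigma$ of $\{1,\dots,n\}$, $\omega_i$ starts at $(0,i)$ and ends at $(\sigma(i)-1,\sigma(i))$, the Left parts are pairwise vertex-disjoint, and the Right parts are pairwise vertex-disjoint. $\mathcal{M}_{n,1}$ is the set of order-$n$ mixed configurations containing exactly one $N$-step (hence exactly one $S$-step). For $(N,E)\in\mathcal{N}_{n,1}$ with generalized inversion table $(k;a_1,\dots,a_n;b,\beta)$, $\Phi(N,E)=(\omega_1,\dots,\omega_n)$ where $\omega_i=E^{a_i}F^{i-1-a_i}$ for $i\notin\{k-1,k\}$, $\omega_{k-1}=E^{a_{k-1}}F^{\beta}NF^{k-2-a_{k-1}-\beta}$, and $\omega_k=E^{a_k}SE^{b}F^{k-2-a_k-b}$ (exponents denote repetition of steps; $\omega_i$ starts at $(0,i)$). Duality: for $\Omega\in\mathcal{M}_{n,1}$, its dual $\overline{\Omega}$ is the unique element of $\mathcal{M}_{n,1}$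 such that, with $\rho(x,y)=(y-1-x,y)$, the set of junctions of $\overline{\Omega}$ is the image under $\rho$ of the set of junctions of $\Omega$, the start vertex of the $S$-step of $\overline{\Omega}$ is $\rho$ of the start vertex of the $S$-step of $\Omega$, and the end vertex of the $N$-step of $\overline{\Omega}$ is $\rho$ of the end vertex of the $N$-step of $\Omega$. Equivalently, if $\Omega=\Phi(N,E)$ where $(N,E)$ has generalized inversion table $(k;a_1,\dots,a_n;b,\beta)$, then $\overline{\Omega}$ is given by the formulas defining $\Phi$ applied to $(k;\overline{a}_1,\dots,\overline{a}_n;\overline{b},\overline{\beta})$ with $\overline{a}_i=i-1-a_i$ ($i\ne k-1$), $\overline{a}_{k-1}=k-2-a_k-b$, $\overline{b}=a_k-1-a_{k-1}$, $\overline{\beta}=a_k+b-a_{k-1}-\beta-1$. *)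

theory Defs
  imports Main
begin

text \<open>An order-n matrix is a function nat => nat => int, with rows/columns indexed
  by 1..n, and all entries outside {1..n} x {1..n} equal to 0 (canonical representation).\<close>

type_synonym mat = "nat \<Rightarrow> nat \<Rightarrow> int"

definition alternating :: "int list \<Rightarrow> bool" where
  "alternating xs \<longleftrightarrow> xs \<noteq> [] \<and> hd xs = 1 \<and> last xs = 1 \<and>
     (\<forall>k. Suc k < length xs \<longrightarrow> xs ! Suc k = - (xs ! k))"

definition row_nz :: "nat \<Rightarrow> mat \<Rightarrow> nat \<Rightarrow> int list" where
  "row_nz n A i = filter (\<lambda>x. x \<noteq> 0) (map (\<lambda>j. A i j) [1..<n+1])"

definition col_nz :: "nat \<Rightarrow> mat \<Rightarrow> nat \<Rightarrow> int list" where
  "col_nz n A j = filter (\<lambda>x. x \<noteq> 0) (map (\<lambda>i. A i j) [1..<n+1])"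

definition is_asm :: "nat \<Rightarrow> mat \<Rightarrow> bool" where
  "is_asm n A \<longleftrightarrow> (\<forall>i j. A i j \<in> {-1, 0, 1}) \<and>
     (\<forall>i j. \<not> (i \<in> {1..n} \<and> j \<in> {1..n}) \<longrightarrow> A i j = 0) \<and>
     (\<forall>i\<in>{1..n}. alternating (row_nz n A i)) \<and>
     (\<forall>j\<in>{1..n}. alternating (col_nz n A j))"

definition asm1 :: "nat \<Rightarrow> mat \<Rightarrow> bool" where
  "asm1 n A \<longleftrightarrow> is_asm n A \<and>
     card {(i, j). i \<in> {1..n} \<and> j \<in> {1..n} \<and> A i j = -1} = 1"

definition reflect :: "nat \<Rightarrow> mat \<Rightarrow> mat" where
  "reflect n A = (\<lambda>i j. if j \<in> {1..n} then A i (n + 1 - j) else 0)"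

definition minus_pos :: "nat \<Rightarrow> mat \<Rightarrow> nat \<times> nat" where
  "minus_pos n A = (THE p. fst p \<in> {1..n} \<and> snd p \<in> {1..n} \<and> A (fst p) (snd p) = -1)"

definition opening_col :: "nat \<Rightarrow> mat \<Rightarrow> nat" where
  "opening_col n A = snd (minus_pos n A)"

definition closing_row :: "nat \<Rightarrow> mat \<Rightarrow> nat" where
  "closing_row n A = fst (minus_pos n A)"

definition opening_row :: "nat \<Rightarrow> mat \<Rightarrow> nat" where
  "opening_row n A = (THE i. i < closing_row n A \<and> A i (opening_col n A) = 1)"

definition closing_col :: "nat \<Rightarrow> mat \<Rightarrow> nat" where
  "closing_col n A = (THE j. opening_col n A < j \<and> A (closing_row n A) j = 1)"

text \<open>Column of the unique 1 of a row (used for rows other than the closing row).\<close>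
definition one_col :: "mat \<Rightarrow> nat \<Rightarrow> nat" where
  "one_col A i = (THE j. A i j = 1)"

definition neutral :: "nat \<Rightarrow> mat \<Rightarrow> bool" where
  "neutral n A \<longleftrightarrow> closing_row n A = Suc (opening_row n A)"

definition positive :: "nat \<Rightarrow> mat \<Rightarrow> bool" where
  "positive n A \<longleftrightarrow> Suc (opening_row n A) < closing_row n A \<and>
     opening_col n A < one_col A (closing_row n A - 1)"

definition negative :: "nat \<Rightarrow> mat \<Rightarrow> bool" where
  "negative n A \<longleftrightarrow> Suc (opening_row n A) < closing_row n A \<and>
     one_col A (closing_row n A - 1) < opening_col n A"

definition leading_row :: "nat \<Rightarrow> mat \<Rightarrow> nat" where
  "leading_row n A = (LEAST i. opening_row n A < i \<and> (\<exists>j. j < opening_col n A \<and> A i j = 1))"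

definition leading_col :: "nat \<Rightarrow> mat \<Rightarrow> nat" where
  "leading_col n A = (THE j. j < opening_col n A \<and> A (leading_row n A) j = 1)"

definition cell_sum :: "mat \<Rightarrow> nat set \<Rightarrow> nat set \<Rightarrow> int" where
  "cell_sum A R C = (\<Sum>(i, j) \<in> R \<times> C. A i j)"

definition ell :: "nat \<Rightarrow> mat \<Rightarrow> int" where
  "ell n A = cell_sum A {opening_row n A<..n} {leading_col n A<..<opening_col n A}"

definition cval :: "nat \<Rightarrow> mat \<Rightarrow> int" where
  "cval n A = cell_sum A {closing_row n A<..n} {opening_col n A<..<closing_col n A}"

definition Eval :: "nat \<Rightarrow> mat \<Rightarrow> int" where
  "Eval n A = (if positive n A then
      cell_sum A {opening_row n A<..<closing_row n A} {opening_col n A<..n} else 0)"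

text \<open>Matrices P of size m x q are again functions, indexed 1..m, 1..q.\<close>

definition Hdisp :: "nat \<Rightarrow> nat \<Rightarrow> mat \<Rightarrow> mat" where
  "Hdisp m q P = (let J = {j \<in> {1..q}. \<exists>i\<in>{1..m}. P i j \<noteq> 0} in
     (\<lambda>i j. if i \<in> {1..m} \<and> j \<in> insert q J \<and> (\<exists>j'\<in>J. j' < j)
            then P i (Max {j' \<in> J. j' < j}) else 0))"

definition Vdisp :: "nat \<Rightarrow> nat \<Rightarrow> mat \<Rightarrow> mat" where
  "Vdisp m q P = (let I = {i \<in> {1..m}. \<exists>j\<in>{1..q}. P i j \<noteq> 0} in
     (\<lambda>i j. if j \<in> {1..q} \<and> i \<in> insert 1 I \<and> (\<exists>i'\<in>I. i < i')
            then P (Min {i' \<in> I. i < i'}) j else 0))"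

definition submat :: "mat \<Rightarrow> nat \<Rightarrow> nat \<Rightarrow> nat \<Rightarrow> nat \<Rightarrow> mat" where
  "submat A r c m q = (\<lambda>i j. if i \<in> {1..m} \<and> j \<in> {1..q} then A (r + i - 1) (c + j - 1) else 0)"

definition replace_block :: "mat \<Rightarrow> nat \<Rightarrow> nat \<Rightarrow> nat \<Rightarrow> nat \<Rightarrow> mat \<Rightarrow> mat" where
  "replace_block A r c m q P =
     (\<lambda>i j. if i \<in> {r..<r+m} \<and> j \<in> {c..<c+q} then P (i + 1 - r) (j + 1 - c) else A i j)"

definition delta :: "nat \<Rightarrow> mat \<Rightarrow> mat" where
  "delta n A = (let oc = opening_col n A; cr = closing_row n A; orow = opening_row n A;
       cc = closing_col n A;
       B1 = (\<lambda>i j. if (i, j) = (cr, oc) \<or> (i, j) = (cr, cc) then 0 else A i j);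
       mH = n - cr; qH = cc - oc + 1;
       B2 = replace_block B1 (cr + 1) oc mH qH (Hdisp mH qH (submat B1 (cr + 1) oc mH qH));
       mV = cr - orow + 1; qV = oc - 1;
       B3 = replace_block B2 orow 1 mV qV (Vdisp mV qV (submat B2 orow 1 mV qV))
     in (\<lambda>i j. if 1 \<le> j \<and> j < oc \<and> orow \<le> i \<and> i \<le> cr then
                 (if i = orow then 0 else B3 (i - 1) j)
               else if oc < j \<and> j \<le> n \<and> orow < i \<and> i \<le> cr then
                 (if i = Suc orow then 0 else B3 (i - 1) j)
               else B3 i j))"

definition Delta :: "nat \<Rightarrow> mat \<Rightarrow> nat \<times> mat \<times> int \<times> int" where
  "Delta n A = (opening_row n A, delta n A, cval n A, Eval n A)"

definition posneut :: "nat \<Rightarrow> mat \<Rightarrow> bool" where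
  "posneut n A \<longleftrightarrow> asm1 n A \<and> (positive n A \<or> neutral n A)"

definition Lambda_pn :: "nat \<Rightarrow> mat \<Rightarrow> mat \<times> int" where
  "Lambda_pn n A = ((THE N. posneut n N \<and>
      Delta n N = (opening_row n A, delta n A, cval n A + Eval n A, 0)), Eval n A)"

definition Lambda :: "nat \<Rightarrow> mat \<Rightarrow> mat \<times> int" where
  "Lambda n A = (if negative n A then
      (reflect n (fst (Lambda_pn n (reflect n A))), - snd (Lambda_pn n (reflect n A)))
     else Lambda_pn n A)"

text \<open>Returns (k, a, b, beta) with a :: nat => int (a i for 1 <= i <= n).\<close>
definition gen_inv_table :: "nat \<Rightarrow> mat \<times> int \<Rightarrow> nat \<times> (nat \<Rightarrow> int) \<times> int \<times> int" where
  "gen_inv_table n NE = (let N = fst NE; E = snd NE; k = n + 1 - opening_row n N;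
     col = (\<lambda>r. if r = closing_row n N then (LEAST j. N r j = 1) else one_col N r);
     a = (\<lambda>i. let r = n + 1 - i in cell_sum N {r<..n} {1..<col r})
   in (k, a, cval n N, E + ell n N))"

datatype step = StE | StF | StS | StN

fun disp :: "step \<Rightarrow> int \<times> int" where
  "disp StE = (1, 0)"
| "disp StF = (1, 0)"
| "disp StS = (0, -1)"
| "disp StN = (1, 1)"

fun walk :: "int \<times> int \<Rightarrow> step list \<Rightarrow> (int \<times> int) list" where
  "walk p [] = [p]"
| "walk p (s # w) = p # walk (fst p + fst (disp s), snd p + snd (disp s)) w"

definition isLeft :: "step \<Rightarrow> bool" where "isLeft s \<longleftrightarrow> s = StS \<or> s = StE"
definition isRight :: "step \<Rightarrow> bool" where "isRight s \<longleftrightarrow> s = StF \<or> s = StN"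

definition lpart :: "step list \<Rightarrow> step list" where "lpart w = takeWhile isLeft w"
definition rpart :: "step list \<Rightarrow> step list" where "rpart w = dropWhile isLeft w"

definition start :: "nat \<Rightarrow> int \<times> int" where "start i = (0, int i)"

definition junction :: "nat \<Rightarrow> step list \<Rightarrow> int \<times> int" where
  "junction i w = last (walk (start i) (lpart w))"

definition left_verts :: "nat \<Rightarrow> step list \<Rightarrow> (int \<times> int) set" where
  "left_verts i w = set (walk (start i) (lpart w))"

definition right_verts :: "nat \<Rightarrow> step list \<Rightarrow> (int \<times> int) set" where
  "right_verts i w = set (walk (junction i w) (rpart w))"

definition in_G :: "nat \<Rightarrow> int \<times> int \<Rightarrow> bool" where
  "in_G n v \<longleftrightarrow> 0 \<le> fst v \<and> fst v < snd v \<and> snd v \<le> int n"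

definition mixed_path :: "nat \<Rightarrow> nat \<Rightarrow> step list \<Rightarrow> bool" where
  "mixed_path n i w \<longleftrightarrow> (\<forall>s\<in>set (rpart w). isRight s) \<and> (\<forall>v\<in>set (walk (start i) w). in_G n v)"

definition endpoint :: "nat \<Rightarrow> step list \<Rightarrow> int \<times> int" where
  "endpoint i w = last (walk (start i) w)"

text \<open>A configuration is a list [omega_1, ..., omega_n]; omega_i = Om ! (i - 1).\<close>
definition mixed_config :: "nat \<Rightarrow> step list list \<Rightarrow> bool" where
  "mixed_config n Om \<longleftrightarrow> length Om = n \<and>
     (\<exists>\<sigma>. bij_betw \<sigma> {1..n} {1..n} \<and>
        (\<forall>i\<in>{1..n}. endpoint i (Om ! (i - 1)) = (int (\<sigma> i) - 1, int (\<sigma> i)))) \<and>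
     (\<forall>i\<in>{1..n}. mixed_path n i (Om ! (i - 1))) \<and>
     (\<forall>i\<in>{1..n}. \<forall>j\<in>{1..n}. i \<noteq> j \<longrightarrow>
        left_verts i (Om ! (i - 1)) \<inter> left_verts j (Om ! (j - 1)) = {}) \<and>
     (\<forall>i\<in>{1..n}. \<forall>j\<in>{1..n}. i \<noteq> j \<longrightarrow>
        right_verts i (Om ! (i - 1)) \<inter> right_verts j (Om ! (j - 1)) = {})"

definition M1 :: "nat \<Rightarrow> step list list \<Rightarrow> bool" where
  "M1 n Om \<longleftrightarrow> mixed_config n Om \<and> (\<Sum>w\<leftarrow>Om. length (filter (\<lambda>s. s = StN) w)) = 1"

definition rep :: "int \<Rightarrow> step \<Rightarrow> step list" where
  "rep e s = replicate (nat e) s"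

definition Phi :: "nat \<Rightarrow> mat \<times> int \<Rightarrow> step list list" where
  "Phi n NE = (case gen_inv_table n NE of (k, a, b, \<beta>) \<Rightarrow>
     map (\<lambda>i. if i = k - 1 then
                 rep (a i) StE @ rep \<beta> StF @ [StN] @ rep (int k - 2 - a i - \<beta>) StF
               else if i = k then
                 rep (a i) StE @ [StS] @ rep b StE @ rep (int k - 2 - a i - b) StF
               else rep (a i) StE @ rep (int i - 1 - a i) StF)
       [1..<n+1])"

definition junctions :: "nat \<Rightarrow> step list list \<Rightarrow> (int \<times> int) set" where
  "junctions n Om = (\<lambda>i. junction i (Om ! (i - 1))) ` {1..n}"

definition S_start :: "nat \<Rightarrow> step list list \<Rightarrow> int \<times> int" where
  "S_start n Om = (THE v. \<exists>i\<in>{1..n}. \<exists>p < length (Om ! (i - 1)).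
      Om ! (i - 1) ! p = StS \<and> walk (start i) (Om ! (i - 1)) ! p = v)"

definition N_end :: "nat \<Rightarrow> step list list \<Rightarrow> int \<times> int" where
  "N_end n Om = (THE v. \<exists>i\<in>{1..n}. \<exists>p < length (Om ! (i - 1)).
      Om ! (i - 1) ! p = StN \<and> walk (start i) (Om ! (i - 1)) ! Suc p = v)"

definition rho :: "int \<times> int \<Rightarrow> int \<times> int" where
  "rho v = (snd v - 1 - fst v, snd v)"

definition dual :: "nat \<Rightarrow> step list list \<Rightarrow> step list list" where
  "dual n Om = (THE Om'. M1 n Om' \<and> junctions n Om' = rho ` junctions n Om \<and>
      S_start n Om' = rho (S_start n Om) \<and> N_end n Om' = rho (N_end n Om))"

end

theory Submission
  imports Defs
begin

text \<open>
  Discharging a positive matrix \<open>A\<close> gives a permutation matrix \<open>P\<close>: step (2) cyclically permutes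
  columns below the closing row, and steps (3) and (4) together permute whole rows. A neutral matrix \<open>N\<close> can
  be rebuilt from \<open>P = \<delta>(N)\<close>, its opening row and \<open>c(N)\<close>: the closing column is the \<open>(c(N) + 1)\<close>-st among the
  columns right of the opening column whose 1 in \<open>P\<close> lies below the closing row, and the column cycle is then
  undone. For positive \<open>A\<close> there are enough such columns, so the neutral matrix with data
  \<open>(k, P, c(A) + E(A), 0)\<close> exists, is unique, and satisfies \<open>0 \<le> E(A) \<le> c(N)\<close>.

  It remains to compare \<open>(N, E)\<close> with \<open>(reflect N, -E)\<close> for neutral \<open>N\<close>. The suffix sums of the columns of \<open>N\<close>
  are nonnegative and the rows below row \<open>x\<close> have total sum \<open>n - x\<close>; hence the two tables are admissible and
  complementary, which is exactly the relation between a configuration and its dual. The dual is well defined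
  because in a configuration with one \<open>N\<close>-step the \<open>S\<close>-step and the \<open>N\<close>-step belong to two consecutive paths, so
  the junctions, the start of the \<open>S\<close>-step and the end of the \<open>N\<close>-step determine all paths.
\<close>

section \<open>Mixed configurations\<close>

text \<open>\<open>Lambda_pn\<close> and \<open>dual\<close> are definite descriptions, so each
  value needs existence and uniqueness. Uniqueness of the neutral partner is a question about
  neutral matrices: the target has charge 0, whereas a positive matrix has the 1 of its lowest
  enclosed row in the charged cell, hence \<open>Eval\<close> > 0. Let \<open>k\<close> be the
  opening row. Discharging a positive \<open>A\<close> leaves a 1 below row \<open>Suc k\<close> in
  two disjoint families of columns right of the opening column: the \<open>c(A) + 1\<close> columns
  filled by the horizontal displacement (the closing column is the extra one) and the
  \<open>E(A)\<close> columns of the charged cell. The latter end strictly below row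
  \<open>Suc k\<close> because that row receives the row of the leading 1, which also becomes the
  left 1 of the closing row of \<open>N\<close>. On the side of paths, the N- and S-steps lie on
  consecutive paths because the end heights must permute the start heights; a path carrying both is
  excluded by the path starting one unit lower, whose Right part would contain its junction. The row
  below the S-step's start carries two junctions, but the disjointness of Left parts orders them, so
  the unlabelled set still identifies them.\<close>

lemma length_rep [simp]: "length (rep e s) = nat e"
  by (simp add: rep_def)

lemma set_rep: "x \<in> set (rep e s) \<Longrightarrow> x = s"
  by (simp add: rep_def)

lemma rep_length: "(\<forall>x\<in>set w. x = s) \<Longrightarrow> w = rep (int (length w)) s"
  by (simp add: rep_def replicate_length_same)

lemma walk_not_Nil [simp]: "walk p w \<noteq> []"
  by (cases w) auto

lemma last_walk_append: "last (walk p (u @ v)) = last (walk (last (walk p u)) v)"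
  by (induction u arbitrary: p) auto

lemma start_in_walk: "p \<in> set (walk p w)"
  by (cases w) auto

lemma set_walk_append: "set (walk p (u @ v)) = set (walk p u) \<union> set (walk (last (walk p u)) v)"
  by (induction u arbitrary: p) (auto simp: start_in_walk)

lemma walk_nth_length: "walk p (u @ v) ! length u = last (walk p u)"
proof (induction u arbitrary: p)
  case Nil show ?case by (cases v) auto
qed auto

text \<open>Turns the endpoint condition of a configuration into a balance of N- and
  S-steps.\<close>

lemma snd_last_walk:
  "snd (last (walk p w)) = snd p + int (length (filter (\<lambda>s. s = StN) w))
     - int (length (filter (\<lambda>s. s = StS) w))"
  by (induction w arbitrary: p rule: list.induct) (auto split: step.splits simp: neq_Nil_conv, (case_tac x1; simp)+)

lemma last_walk_rep:
  assumes "disp s = (1, 0)" "0 \<le> e"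
  shows "last (walk (x, y) (rep e s @ w)) = last (walk (x + e, y) w)"
proof -
  have "last (walk (x, y) (replicate t s @ w)) = last (walk (x + int t, y) w)" for t
    by (induction t arbitrary: x) (auto simp: assms algebra_simps)
  from this[of "nat e"] show ?thesis using assms by (simp add: rep_def)
qed

lemma set_walk_rep:
  assumes "disp s = (1, 0)" "0 \<le> e"
  shows "set (walk (x, y) (rep e s @ w)) = {x..<x+e} \<times> {y} \<union> set (walk (x + e, y) w)"
proof -
  have "set (walk (x, y) (replicate t s @ w)) = {x..<x+int t} \<times> {y} \<union> set (walk (x + int t, y) w)" for t
  proof (induction t arbitrary: x)
    case (Suc t)
    have "{x..<x+int (Suc t)} = insert x {x+1..<x+1+int t}" by auto
    then show ?case by (auto simp: assms Suc algebra_simps)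
  qed simp
  from this[of "nat e"] show ?thesis using assms by (simp add: rep_def)
qed

lemmas walk_rep = last_walk_rep[of StE] last_walk_rep[of StF] set_walk_rep[of StE] set_walk_rep[of StF]
  last_walk_rep[of StE _ _ _ "[]", simplified] last_walk_rep[of StF _ _ _ "[]", simplified]
  set_walk_rep[of StE _ _ _ "[]", simplified] set_walk_rep[of StF _ _ _ "[]", simplified]

lemma lpart_rpart_append:
  assumes "\<forall>x\<in>set u. isLeft x" "\<forall>x\<in>set v. isRight x"
  shows "lpart (u @ v) = u" "rpart (u @ v) = v"
proof -
  have v: "v = [] \<or> \<not> isLeft (hd v)"
    using assms(2) by (cases v) (auto simp: isLeft_def isRight_def)
  then have "takeWhile isLeft v = []" "dropWhile isLeft v = v"
    by (cases v; simp)+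
  then show "lpart (u @ v) = u" "rpart (u @ v) = v"
    using assms(1) by (simp_all add: lpart_def rpart_def)
qed

lemma lpart_append_rpart: "lpart w @ rpart w = w"
  by (simp add: lpart_def rpart_def)

lemma lpart_isLeft: "x \<in> set (lpart w) \<Longrightarrow> isLeft x"
  by (auto simp: lpart_def dest: set_takeWhileD)

lemma walk_verts: "set (walk (start i) w) = left_verts i w \<union> right_verts i w"
  unfolding left_verts_def right_verts_def junction_def
  by (metis set_walk_append lpart_append_rpart)

lemma endpoint_right: "endpoint i w = last (walk (junction i w) (rpart w))"
  unfolding endpoint_def junction_def by (metis last_walk_append lpart_append_rpart)

lemma mixed_path_iff:
  "mixed_path n i w \<longleftrightarrow> (\<forall>s\<in>set (rpart w). isRight s) \<and> (\<forall>v\<in>left_verts i w \<union> right_verts i w. in_G n v)"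
  by (simp add: mixed_path_def walk_verts)

section \<open>The three shapes of paths and their vertices\<close>

text \<open>These are the three words in the definition of \<open>Phi\<close>, with the number
  \<open>f\<close> of final F-steps left free: in \<open>M1_imp_config\<close> the shape of a path
  is known first, and \<open>f\<close> is only computed afterwards from the endpoint.\<close>

definition plain_path :: "int \<Rightarrow> int \<Rightarrow> step list" where
  "plain_path a f = rep a StE @ rep f StF"

definition up_path :: "int \<Rightarrow> int \<Rightarrow> int \<Rightarrow> step list" where
  "up_path a \<beta> f = rep a StE @ rep \<beta> StF @ [StN] @ rep f StF"

definition down_path :: "int \<Rightarrow> int \<Rightarrow> int \<Rightarrow> step list" where
  "down_path a b f = rep a StE @ [StS] @ rep b StE @ rep f StF"

lemma plain_path_parts:
  "lpart (plain_path a f) = rep a StE" "rpart (plain_path a f) = rep f StF"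
  unfolding plain_path_def
  by (rule lpart_rpart_append; auto dest: set_rep simp: isLeft_def isRight_def)+

lemma up_path_parts:
  "lpart (up_path a \<beta> f) = rep a StE" "rpart (up_path a \<beta> f) = rep \<beta> StF @ [StN] @ rep f StF"
  unfolding up_path_def
  by (rule lpart_rpart_append; auto dest: set_rep simp: isLeft_def isRight_def)+

lemma down_path_parts:
  "lpart (down_path a b f) = rep a StE @ [StS] @ rep b StE" "rpart (down_path a b f) = rep f StF"
  using lpart_rpart_append[of "rep a StE @ [StS] @ rep b StE" "rep f StF"]
  by (auto simp: down_path_def isLeft_def isRight_def dest: set_rep)

lemma plain_path_verts:
  assumes "0 \<le> a" "0 \<le> f"
  shows "left_verts i (plain_path a f) = {0..a} \<times> {int i}"
    "junction i (plain_path a f) = (a, int i)"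
    "right_verts i (plain_path a f) = {a..a+f} \<times> {int i}"
    "endpoint i (plain_path a f) = (a + f, int i)"
proof -
  show "left_verts i (plain_path a f) = {0..a} \<times> {int i}"
    using assms by (auto simp: left_verts_def plain_path_parts walk_rep start_def)
  show *: "junction i (plain_path a f) = (a, int i)"
    using assms by (auto simp: junction_def plain_path_parts walk_rep start_def)
  show "right_verts i (plain_path a f) = {a..a+f} \<times> {int i}"
    using assms by (auto simp: right_verts_def * plain_path_parts walk_rep start_def)
  show "endpoint i (plain_path a f) = (a + f, int i)"
    using assms by (auto simp: endpoint_right * plain_path_parts walk_rep start_def)
qed

lemma up_path_verts:
  assumes "0 \<le> a" "0 \<le> \<beta>" "0 \<le> f"
  shows "left_verts i (up_path a \<beta> f) = {0..a} \<times> {int i}"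
    "junction i (up_path a \<beta> f) = (a, int i)"
    "right_verts i (up_path a \<beta> f) = {a..a+\<beta>} \<times> {int i} \<union> {a+\<beta>+1..a+\<beta>+1+f} \<times> {int i + 1}"
    "endpoint i (up_path a \<beta> f) = (a + \<beta> + 1 + f, int i + 1)"
proof -
  show "left_verts i (up_path a \<beta> f) = {0..a} \<times> {int i}"
    using assms by (auto simp: left_verts_def up_path_parts walk_rep start_def)
  show *: "junction i (up_path a \<beta> f) = (a, int i)"
    using assms by (auto simp: junction_def up_path_parts walk_rep start_def)
  show "right_verts i (up_path a \<beta> f) = {a..a+\<beta>} \<times> {int i} \<union> {a+\<beta>+1..a+\<beta>+1+f} \<times> {int i + 1}"
    using assms by (auto simp: right_verts_def * up_path_parts walk_rep start_def)
  show "endpoint i (up_path a \<beta> f) = (a + \<beta> + 1 + f, int i + 1)"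
    using assms by (auto simp: endpoint_right * up_path_parts walk_rep start_def)
qed

lemma down_path_verts:
  assumes "0 \<le> a" "0 \<le> b" "0 \<le> f"
  shows "left_verts i (down_path a b f) = {0..a} \<times> {int i} \<union> {a..a+b} \<times> {int i - 1}"
    "junction i (down_path a b f) = (a + b, int i - 1)"
    "right_verts i (down_path a b f) = {a+b..a+b+f} \<times> {int i - 1}"
    "endpoint i (down_path a b f) = (a + b + f, int i - 1)"
proof -
  show "left_verts i (down_path a b f) = {0..a} \<times> {int i} \<union> {a..a+b} \<times> {int i - 1}"
    using assms by (auto simp: left_verts_def down_path_parts walk_rep start_def)
  show *: "junction i (down_path a b f) = (a + b, int i - 1)"
    using assms by (auto simp: junction_def down_path_parts walk_rep start_def)
  show "right_verts i (down_path a b f) = {a+b..a+b+f} \<times> {int i - 1}"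
    using assms by (auto simp: right_verts_def * down_path_parts walk_rep start_def)
  show "endpoint i (down_path a b f) = (a + b + f, int i - 1)"
    using assms by (auto simp: endpoint_right * down_path_parts walk_rep start_def)
qed

text \<open>Note that the \<open>k\<close> of a table is \<open>n + 1\<close> minus the opening row, which is called \<open>k\<close> from the next section on.\<close>

definition config_path :: "nat \<Rightarrow> (nat \<Rightarrow> int) \<Rightarrow> int \<Rightarrow> int \<Rightarrow> nat \<Rightarrow> step list" where
  "config_path k a b \<beta> i =
     (if i = k - 1 then up_path (a i) \<beta> (int k - 2 - a i - \<beta>)
      else if i = k then down_path (a i) b (int k - 2 - a i - b)
      else plain_path (a i) (int i - 1 - a i))"

definition config :: "nat \<Rightarrow> nat \<Rightarrow> (nat \<Rightarrow> int) \<Rightarrow> int \<Rightarrow> int \<Rightarrow> step list list" where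
  "config n k a b \<beta> = map (config_path k a b \<beta>) [1..<n+1]"

lemma Phi_eq_config:
  "gen_inv_table n NE = (k, a, b, \<beta>) \<Longrightarrow> Phi n NE = config n k a b \<beta>"
  by (simp add: Phi_def config_def config_path_def[abs_def] up_path_def down_path_def plain_path_def)

lemma length_config [simp]: "length (config n k a b \<beta>) = n"
  by (simp add: config_def)

lemma config_nth: "i \<in> {1..n} \<Longrightarrow> config n k a b \<beta> ! (i - 1) = config_path k a b \<beta> i"
  by (cases i) (auto simp: config_def simp del: upt_Suc)

lemmas config_nths = config_nth config_nth[unfolded One_nat_def]

lemma config_eqI:
  assumes "length Om = n" "\<And>i. i \<in> {1..n} \<Longrightarrow> Om ! (i - 1) = config_path k a b \<beta> i"
  shows "Om = config n k a b \<beta>"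
proof (rule nth_equalityI)
  fix i assume "i < length Om"
  then show "Om ! i = config n k a b \<beta> ! i"
    using assms(2)[of "Suc i"] config_nth[of "Suc i" n] assms(1) by simp
qed (simp add: assms)

section \<open>Admissible tables and their configurations\<close>

text \<open>The two strict inequalities are disjointness in row \<open>k - 1\<close>, the row shared
  by the paths \<open>k - 1\<close> and \<open>k\<close>: the first concerns the Left parts, the
  second the Right parts. The bound \<open>a k + b \<le> int k - 2\<close> keeps path
  \<open>k\<close> inside the region after its S-step. The index \<open>k - 1\<close> is exempt from
  the upper bound on \<open>a i\<close> because the inequalities in the last line force a stronger
  one.\<close>

definition valid_table :: "nat \<Rightarrow> nat \<Rightarrow> (nat \<Rightarrow> int) \<Rightarrow> int \<Rightarrow> int \<Rightarrow> bool" where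
  "valid_table n k a b \<beta> \<longleftrightarrow> 2 \<le> k \<and> k \<le> n \<and>
     (\<forall>i\<in>{1..n}. 0 \<le> a i \<and> (i \<noteq> k - 1 \<longrightarrow> a i \<le> int i - 1)) \<and>
     0 \<le> b \<and> a (k - 1) < a k \<and> a k + b \<le> int k - 2 \<and> 0 \<le> \<beta> \<and> a (k - 1) + \<beta> < a k + b"

lemma nth_unique_position:
  assumes "xs = u @ s # w" "s \<notin> set u" "s \<notin> set w"
  shows "p < length xs \<and> xs ! p = s \<longleftrightarrow> p = length u"
proof
  assume p: "p < length xs \<and> xs ! p = s"
  show "p = length u"
  proof (rule ccontr)
    assume "p \<noteq> length u"
    then consider "p < length u" | "length u < p" by linarith
    then show False
    proof cases
      case 1
      then show ?thesis using p assms by (auto simp: nth_append)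
    next
      case 2
      then have "xs ! p = w ! (p - Suc (length u))" "p - Suc (length u) < length w"
        using p assms(1) by (auto simp: nth_append nth_Cons')
      then show ?thesis using p assms(3) by (metis nth_mem)
    qed
  qed
qed (simp add: assms)

lemma count_StN:
  "filter (\<lambda>s. s = StN) (plain_path a f) = []"
  "filter (\<lambda>s. s = StN) (down_path a b f) = []"
  "filter (\<lambda>s. s = StN) (up_path a \<beta> f) = [StN]"
  by (simp_all add: plain_path_def down_path_def up_path_def rep_def)

lemma sum_list_upto: "(\<Sum>i\<leftarrow>[1..<n+1]. f i) = (\<Sum>i\<in>{1..n}. (f i :: nat))"
  using sum_list_distinct_conv_sum_set[of "[1..<n+1]" f]
  by (simp add: atLeastLessThanSuc_atLeastAtMost del: upt_Suc)

lemma notin_rep: "x \<noteq> s \<Longrightarrow> x \<notin> set (rep e s)"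
  by (auto dest: set_rep)

context
  fixes n k a b \<beta>
  assumes valid: "valid_table n k a b \<beta>"
begin

lemma validD:
  "2 \<le> k" "k \<le> n" "i \<in> {1..n} \<Longrightarrow> 0 \<le> a i" "i \<in> {1..n} \<Longrightarrow> i \<noteq> k - 1 \<Longrightarrow> a i \<le> int i - 1"
  "0 \<le> b" "a (k - 1) < a k" "a k + b \<le> int k - 2" "0 \<le> \<beta>" "a (k - 1) + \<beta> < a k + b"
  "0 \<le> a (k - 1)" "0 \<le> a k"
proof -
  have "k - 1 \<in> {1..n}" "k \<in> {1..n}" using valid by (auto simp: valid_table_def)
  then show "0 \<le> a (k - 1)" "0 \<le> a k" using valid unfolding valid_table_def by blast+
qed (use valid in \<open>auto simp: valid_table_def\<close>)

lemma config_path_verts: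
  assumes "i \<in> {1..n}"
  shows "left_verts i (config_path k a b \<beta> i) = {0..a i} \<times> {int i} \<union>
      (if i = k then {a k..a k+b} \<times> {int k - 1} else {})"
    "junction i (config_path k a b \<beta> i) = (if i = k then (a k + b, int k - 1) else (a i, int i))"
    "right_verts i (config_path k a b \<beta> i) =
      (if i = k then {a k + b..int k - 2} \<times> {int k - 1}
       else if i = k - 1 then {a i..a i+\<beta>} \<times> {int k - 1} \<union> {a i+\<beta>+1..int k - 1} \<times> {int k}
       else {a i..int i - 1} \<times> {int i})"
    "endpoint i (config_path k a b \<beta> i) =
      (if i = k then (int k - 2, int k - 1) else if i = k - 1 then (int k - 1, int k)
       else (int i - 1, int i))"
proof -
  have k: "k \<noteq> k - 1" "int (k - 1) = int k - 1" using validD by auto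
  note v = validD(1,2,5-) validD(3)[OF assms] validD(4)[OF assms]
  consider "i = k" | "i = k - 1" "i \<noteq> k" | "i \<noteq> k" "i \<noteq> k - 1" by blast
  then have "left_verts i (config_path k a b \<beta> i) = {0..a i} \<times> {int i} \<union>
      (if i = k then {a k..a k+b} \<times> {int k - 1} else {}) \<and>
    junction i (config_path k a b \<beta> i) = (if i = k then (a k + b, int k - 1) else (a i, int i)) \<and>
    right_verts i (config_path k a b \<beta> i) =
      (if i = k then {a k + b..int k - 2} \<times> {int k - 1}
       else if i = k - 1 then {a i..a i+\<beta>} \<times> {int k - 1} \<union> {a i+\<beta>+1..int k - 1} \<times> {int k}
       else {a i..int i - 1} \<times> {int i}) \<and>
    endpoint i (config_path k a b \<beta> i) =
      (if i = k then (int k - 2, int k - 1) else if i = k - 1 then (int k - 1, int k)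
       else (int i - 1, int i))"
  proof cases
    case 1
    show ?thesis using v k
      by (simp add: config_path_def 1 down_path_verts)
  next
    case 2
    show ?thesis using v k
      by (simp add: config_path_def 2 up_path_verts)
  next
    case 3
    show ?thesis using v 3
      by (simp add: config_path_def plain_path_verts)
  qed
  then show "left_verts i (config_path k a b \<beta> i) = {0..a i} \<times> {int i} \<union>
      (if i = k then {a k..a k+b} \<times> {int k - 1} else {})"
    "junction i (config_path k a b \<beta> i) = (if i = k then (a k + b, int k - 1) else (a i, int i))"
    "right_verts i (config_path k a b \<beta> i) =
      (if i = k then {a k + b..int k - 2} \<times> {int k - 1}
       else if i = k - 1 then {a i..a i+\<beta>} \<times> {int k - 1} \<union> {a i+\<beta>+1..int k - 1} \<times> {int k}
       else {a i..int i - 1} \<times> {int i})"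
    "endpoint i (config_path k a b \<beta> i) =
      (if i = k then (int k - 2, int k - 1) else if i = k - 1 then (int k - 1, int k)
       else (int i - 1, int i))"
    by blast+
qed

lemma config_path_rpart: "s \<in> set (rpart (config_path k a b \<beta> i)) \<Longrightarrow> isRight s"
  by (auto simp: config_path_def plain_path_parts up_path_parts down_path_parts isRight_def split: if_splits dest: set_rep)

text \<open>Every row other than \<open>k - 1\<close> and \<open>k\<close> is used by one path only.
  In row \<open>k\<close> the Left part belongs to path \<open>k\<close> and the Right part to path
  \<open>k - 1\<close>, so disjointness has content only in row \<open>k - 1\<close>, where it is
  the pair of strict inequalities of \<open>valid_table\<close>.\<close>

lemma mixed_config_config: "mixed_config n (config n k a b \<beta>)"
  unfolding mixed_config_def
proof (intro conjI ballI impI)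
  have row: "int j = int k - 1 \<longleftrightarrow> j = k - 1" "int k - 1 = int j \<longleftrightarrow> j = k - 1" for j
    using validD(1) by auto
  show "length (config n k a b \<beta>) = n" by simp
  show "\<exists>\<sigma>. bij_betw \<sigma> {1..n} {1..n} \<and>
        (\<forall>i\<in>{1..n}. endpoint i (config n k a b \<beta> ! (i - 1)) = (int (\<sigma> i) - 1, int (\<sigma> i)))"
  proof (intro exI conjI ballI)
    let ?s = "\<lambda>i. if i = k then k - 1 else if i = k - 1 then k else i"
    show "bij_betw ?s {1..n} {1..n}"
      by (rule bij_betw_byWitness[where f' = ?s]) (use validD in auto)
    show "endpoint i (config n k a b \<beta> ! (i - 1)) = (int (?s i) - 1, int (?s i))" if "i \<in> {1..n}" for i
      using validD(1,2,5-) that unfolding config_nth[OF that] config_path_verts[OF that] by auto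
  qed
  show "mixed_path n i (config n k a b \<beta> ! (i - 1))" if "i \<in> {1..n}" for i
    using validD(1,2,5-) validD(3,4)[OF that] that
    unfolding mixed_path_iff config_nth[OF that] config_path_verts[OF that]
    by (auto simp: in_G_def intro: config_path_rpart split: if_splits)
  show "left_verts i (config n k a b \<beta> ! (i - 1)) \<inter> left_verts j (config n k a b \<beta> ! (j - 1)) = {}"
    if "i \<in> {1..n}" "j \<in> {1..n}" "i \<noteq> j" for i j
    using validD(1,2,5-) that(3)
    unfolding config_nth[OF that(1)] config_nth[OF that(2)] config_path_verts[OF that(1)] config_path_verts[OF that(2)]
    by (auto simp: row split: if_splits)
  show "right_verts i (config n k a b \<beta> ! (i - 1)) \<inter> right_verts j (config n k a b \<beta> ! (j - 1)) = {}"
    if "i \<in> {1..n}" "j \<in> {1..n}" "i \<noteq> j" for i j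
    using validD(1,2,5-) that(3)
    unfolding config_nth[OF that(1)] config_nth[OF that(2)] config_path_verts[OF that(1)] config_path_verts[OF that(2)]
    by (auto simp: row split: if_splits)
qed

lemma M1_config: "M1 n (config n k a b \<beta>)"
proof -
  have "(\<Sum>w\<leftarrow>config n k a b \<beta>. length (filter (\<lambda>s. s = StN) w)) =
      (\<Sum>i\<in>{1..n}. length (filter (\<lambda>s. s = StN) (config_path k a b \<beta> i)))"
    unfolding sum_list_upto[symmetric] by (simp add: config_def comp_def)
  also have "\<dots> = (\<Sum>i\<in>{1..n}. if i = k - 1 then 1 else 0)"
    by (rule sum.cong) (auto simp: config_path_def count_StN)
  also have "\<dots> = (if k - 1 \<in> {1..n} then 1 else 0)" by (simp only: sum.delta finite_atLeastAtMost)
  also have "\<dots> = 1" using validD(1,2) by auto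
  finally show ?thesis using mixed_config_config by (simp add: M1_def)
qed

lemma junctions_config:
  "junctions n (config n k a b \<beta>) = insert (a k + b, int k - 1) ((\<lambda>i. (a i, int i)) ` ({1..n} - {k}))"
proof -
  have "junctions n (config n k a b \<beta>) = (\<lambda>i. if i = k then (a k + b, int k - 1) else (a i, int i)) ` {1..n}"
    unfolding junctions_def by (rule image_cong) (simp_all only: config_nth config_path_verts)
  also have "{1..n} = insert k ({1..n} - {k})" using validD(1,2) by auto
  finally show ?thesis by (auto simp: image_iff)
qed

lemma S_start_config: "S_start n (config n k a b \<beta>) = (a k, int k)"
proof -
  have k1: "k \<noteq> k - 1" using validD(1) by simp
  have p: "p < length (config_path k a b \<beta> i) \<and> config_path k a b \<beta> i ! p = StS \<longleftrightarrow> i = k \<and> p = nat (a k)"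
    if "i \<in> {1..n}" for i p
  proof (cases "i = k")
    case True
    then show ?thesis
      using nth_unique_position[of "config_path k a b \<beta> i" "rep (a k) StE" StS _ p] validD(1,2,5-)
      by (auto simp: config_path_def down_path_def notin_rep)
  next
    case False
    then have "StS \<notin> set (config_path k a b \<beta> i)"
      by (auto simp: config_path_def plain_path_def up_path_def notin_rep)
    then show ?thesis using False by (metis nth_mem)
  qed
  have "walk (start k) (config_path k a b \<beta> k) ! nat (a k) = (a k, int k)"
    using k1 walk_nth_length[of "start k" "rep (a k) StE"] validD(1,2,5-)
    by (simp add: config_path_def down_path_def start_def walk_rep)
  moreover have "k \<in> {1..n}" using validD(1,2) by auto
  moreover have "(\<exists>i\<in>{1..n}. \<exists>p < length (config n k a b \<beta> ! (i - 1)).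
      config n k a b \<beta> ! (i - 1) ! p = StS \<and> walk (start i) (config n k a b \<beta> ! (i - 1)) ! p = v) \<longleftrightarrow>
      (\<exists>i\<in>{1..n}. \<exists>p. i = k \<and> p = nat (a k) \<and> walk (start i) (config_path k a b \<beta> i) ! p = v)" for v
    using p by (intro bex_cong[OF refl]) (metis config_nth)
  ultimately show ?thesis unfolding S_start_def by auto
qed

lemma N_end_config: "N_end n (config n k a b \<beta>) = (a (k-1) + \<beta> + 1, int k)"
proof -
  let ?u = "rep (a (k-1)) StE @ rep \<beta> StF"
  have p: "p < length (config_path k a b \<beta> i) \<and> config_path k a b \<beta> i ! p = StN \<longleftrightarrow>
     i = k - 1 \<and> p = length ?u"
    if "i \<in> {1..n}" for i p
  proof (cases "i = k - 1")
    case True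
    then show ?thesis
      using nth_unique_position[of "config_path k a b \<beta> i" ?u StN _ p] validD(1,2,5-)
      by (auto simp: config_path_def up_path_def notin_rep)
  next
    case False
    then have "StN \<notin> set (config_path k a b \<beta> i)"
      by (auto simp: config_path_def plain_path_def down_path_def notin_rep)
    then show ?thesis using False by (metis nth_mem)
  qed
  have "walk (start (k-1)) (config_path k a b \<beta> (k-1)) ! Suc (length ?u) = (a (k-1) + \<beta> + 1, int k)"
    using walk_nth_length[of "start (k-1)" "?u @ [StN]"] validD(1,2,5-)
    by (simp add: config_path_def up_path_def start_def walk_rep)
  moreover have "k - 1 \<in> {1..n}" using validD(1,2) by auto
  moreover have "(\<exists>i\<in>{1..n}. \<exists>p < length (config n k a b \<beta> ! (i - 1)).
      config n k a b \<beta> ! (i - 1) ! p = StN \<and> walk (start i) (config n k a b \<beta> ! (i - 1)) ! Suc p = v) \<longleftrightarrow>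
      (\<exists>i\<in>{1..n}. \<exists>p. i = k - 1 \<and> p = length ?u \<and> walk (start i) (config_path k a b \<beta> i) ! Suc p = v)" for v
    using p by (intro bex_cong[OF refl]) (metis config_nth)
  ultimately show ?thesis unfolding N_end_def by auto
qed

end


text \<open>The start of the S-step gives \<open>k\<close> and \<open>a k\<close>, and a row other
  than \<open>k - 1\<close> and \<open>k\<close> holds one junction, which gives \<open>a i\<close>.
  Row \<open>k - 1\<close> holds the two junctions with abscissas \<open>a (k - 1)\<close> and
  \<open>a k + b\<close>; since \<open>a (k - 1) < a k\<close> the smaller one is the former. The
  end of the N-step then gives \<open>\<beta>\<close>.\<close>

lemma valid_table_unique:
  assumes v: "valid_table n k a b \<beta>" and v': "valid_table n k' a' b' \<beta>'"
    and j: "junctions n (config n k a b \<beta>) = junctions n (config n k' a' b' \<beta>')"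
    and s: "S_start n (config n k a b \<beta>) = S_start n (config n k' a' b' \<beta>')"
    and e: "N_end n (config n k a b \<beta>) = N_end n (config n k' a' b' \<beta>')"
  shows "config n k a b \<beta> = config n k' a' b' \<beta>'"
proof -
  have k: "k' = k" "a' k = a k"
    using s by (auto simp: S_start_config[OF v] S_start_config[OF v'])
  note d = validD(1,2,5-)[OF v] validD(1,2,5-)[OF v', unfolded k]
  have J: "insert (a k + b, int k - 1) ((\<lambda>i. (a i, int i)) ` ({1..n} - {k})) =
     insert (a k + b', int k - 1) ((\<lambda>i. (a' i, int i)) ` ({1..n} - {k}))"
    using j unfolding junctions_config[OF v] junctions_config[OF v'] unfolding k .
  have row: "x = a i \<or> i = k - 1 \<and> x = a k + b \<longleftrightarrow> x = a' i \<or> i = k - 1 \<and> x = a k + b'"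
    if i: "i \<in> {1..n}" "i \<noteq> k" for i x
  proof -
    have "(x, int i) \<in> insert (a k + b, int k - 1) ((\<lambda>i. (a i, int i)) ` ({1..n} - {k})) \<longleftrightarrow>
        x = a i \<or> i = k - 1 \<and> x = a k + b" using i d(1) by auto
    moreover have "(x, int i) \<in> insert (a k + b', int k - 1) ((\<lambda>i. (a' i, int i)) ` ({1..n} - {k})) \<longleftrightarrow>
        x = a' i \<or> i = k - 1 \<and> x = a k + b'" using i d(1) by auto
    ultimately show ?thesis unfolding J by blast
  qed
  have k1: "k - 1 \<in> {1..n}" "k - 1 \<noteq> k" using d by auto
  have ab: "a' (k - 1) = a (k - 1) \<and> b' = b"
    using row[OF k1, of "a (k - 1)"] row[OF k1, of "a k + b"] row[OF k1, of "a' (k - 1)"]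
      row[OF k1, of "a k + b'"] d k by auto
  have beta: "\<beta>' = \<beta>"
    using e ab unfolding N_end_config[OF v] N_end_config[OF v'] unfolding k by simp
  have "a' i = a i" if "i \<in> {1..n}" for i
    using row[OF that, of "a i"] k(2) ab by (cases "i = k"; cases "i = k - 1") auto
  then show ?thesis
    by (intro config_eqI) (auto simp: config_nths k ab beta config_path_def)
qed

section \<open>Every configuration with one N-step comes from an admissible table\<close>

lemma sum_eq_one_nat:
  assumes "finite I" "(\<Sum>i\<in>I. f i) = (1::nat)"
  obtains i where "i \<in> I" "f i = 1" "\<And>j. j \<in> I \<Longrightarrow> j \<noteq> i \<Longrightarrow> f j = 0"
proof -
  from assms obtain i where i: "i \<in> I" "f i \<noteq> 0" by (metis sum.neutral zero_neq_one)
  then have "f i + sum f (I - {i}) = 1" using assms by (simp add: sum.remove)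
  then have "f i = 1" "sum f (I - {i}) = 0" using i(2) by linarith+
  then show thesis using that i assms(1) by (auto simp: sum_eq_0_iff)
qed

lemma only_letter:
  assumes "\<forall>x\<in>set w. x = s \<or> x = t" "length (filter (\<lambda>x. x = t) w) = 0"
  shows "w = rep (int (length w)) s"
  using assms by (intro rep_length) (auto simp: filter_empty_conv)

lemma letter_once:
  assumes "\<forall>x\<in>set w. x = s \<or> x = t" "length (filter (\<lambda>x. x = t) w) = 1"
  obtains x y where "w = rep (int x) s @ [t] @ rep (int y) s"
proof -
  have "filter (\<lambda>x. x = t) w \<noteq> []" using assms(2) by auto
  then have "t \<in> set w" by (auto simp: filter_empty_conv)
  then obtain u v where w: "w = u @ t # v" "t \<notin> set u" using split_list_first[of t w] by blast
  have u: "u = rep (int (length u)) s"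
    by (rule only_letter[of u s t]) (use w assms(1) in \<open>auto simp: filter_empty_conv\<close>)
  have v: "v = rep (int (length v)) s"
    by (rule only_letter[of v s t]) (use w assms in auto)
  have "w = rep (int (length u)) s @ [t] @ rep (int (length v)) s"
    unfolding u[symmetric] v[symmetric] by (simp add: w(1))
  then show thesis by (rule that)
qed

lemma mixed_word_counts:
  assumes "\<forall>s\<in>set (rpart w). isRight s"
  shows "\<forall>x\<in>set (lpart w). x = StE \<or> x = StS" "\<forall>x\<in>set (rpart w). x = StF \<or> x = StN"
    "length (filter (\<lambda>x. x = StS) w) = length (filter (\<lambda>x. x = StS) (lpart w))"
    "length (filter (\<lambda>x. x = StN) w) = length (filter (\<lambda>x. x = StN) (rpart w))"
proof -
  show 1: "\<forall>x\<in>set (lpart w). x = StE \<or> x = StS" using lpart_isLeft by (auto simp: isLeft_def)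
  show 2: "\<forall>x\<in>set (rpart w). x = StF \<or> x = StN" using assms by (auto simp: isRight_def)
  have "filter (\<lambda>x. x = StS) (rpart w) = []" "filter (\<lambda>x. x = StN) (lpart w) = []"
    using 1 2 by (auto simp: filter_empty_conv)
  moreover have "filter P w = filter P (lpart w) @ filter P (rpart w)" for P
    by (metis filter_append lpart_append_rpart)
  ultimately show "length (filter (\<lambda>x. x = StS) w) = length (filter (\<lambda>x. x = StS) (lpart w))"
    "length (filter (\<lambda>x. x = StN) w) = length (filter (\<lambda>x. x = StN) (rpart w))" by simp_all
qed

lemma M1_imp_config:
  assumes "M1 n Om"
  obtains k a b \<beta> where "valid_table n k a b \<beta>" "Om = config n k a b \<beta>"
proof -
  define w where "w i = Om ! (i - 1)" for i
  define cN where "cN i = length (filter (\<lambda>s. s = StN) (w i))" for i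
  define cS where "cS i = length (filter (\<lambda>s. s = StS) (w i))" for i
  from assms have len: "length Om = n" and mix: "\<And>i. i \<in> {1..n} \<Longrightarrow> mixed_path n i (w i)"
    and L: "\<And>i j. i \<in> {1..n} \<Longrightarrow> j \<in> {1..n} \<Longrightarrow> i \<noteq> j \<Longrightarrow> left_verts i (w i) \<inter> left_verts j (w j) = {}"
    and R: "\<And>i j. i \<in> {1..n} \<Longrightarrow> j \<in> {1..n} \<Longrightarrow> i \<noteq> j \<Longrightarrow> right_verts i (w i) \<inter> right_verts j (w j) = {}"
    and N: "(\<Sum>w\<leftarrow>Om. length (filter (\<lambda>s. s = StN) w)) = 1"
    by (auto simp: M1_def mixed_config_def w_def)
  from assms obtain \<sigma> where sig: "bij_betw \<sigma> {1..n} {1..n}"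
    and ep: "\<And>i. i \<in> {1..n} \<Longrightarrow> endpoint i (w i) = (int (\<sigma> i) - 1, int (\<sigma> i))"
    by (auto simp: M1_def mixed_config_def w_def)
  have G: "in_G n v" if "i \<in> {1..n}" "v \<in> left_verts i (w i) \<union> right_verts i (w i)" for i v
    using mix[OF that(1)] that(2) by (auto simp: mixed_path_iff)
  have "Om = map w [1..<n+1]"
    by (rule nth_equalityI) (auto simp: len w_def simp del: upt_Suc)
  then have sumN: "(\<Sum>i\<in>{1..n}. cN i) = 1"
    using N sum_list_upto[of cN n] by (simp add: cN_def comp_def del: upt_Suc)
  have sig_eq: "int (\<sigma> i) = int i + int (cN i) - int (cS i)" if "i \<in> {1..n}" for i
    using ep[OF that] snd_last_walk[of "start i" "w i"]
    by (simp add: endpoint_def cN_def cS_def start_def)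
  \<comment> \<open>A permutation preserves the sum of the heights, so there are as many S-steps as
    N-steps in total, namely one.\<close>
  have "(\<Sum>i\<in>{1..n}. int (\<sigma> i)) = (\<Sum>i\<in>{1..n}. int i)"
    using sum.reindex_bij_betw[OF sig, of int] by simp
  then have "(\<Sum>i\<in>{1..n}. int (cN i)) = (\<Sum>i\<in>{1..n}. int (cS i))"
    by (simp add: sig_eq sum.distrib sum_subtractf)
  then have sumS: "(\<Sum>i\<in>{1..n}. cS i) = 1"
    using sumN by (metis of_nat_1 of_nat_eq_iff of_nat_sum)
  obtain p where p: "p \<in> {1..n}" "cN p = 1" "\<And>j. j \<in> {1..n} \<Longrightarrow> j \<noteq> p \<Longrightarrow> cN j = 0"
    using sum_eq_one_nat[OF _ sumN] by auto
  obtain k where k: "k \<in> {1..n}" "cS k = 1" "\<And>j. j \<in> {1..n} \<Longrightarrow> j \<noteq> k \<Longrightarrow> cS j = 0"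
    using sum_eq_one_nat[OF _ sumS] by auto
  have parts: "\<forall>s\<in>set (rpart (w i)). isRight s" if "i \<in> {1..n}" for i
    using mix[OF that] by (simp add: mixed_path_def)
  note cnt = mixed_word_counts[OF parts]
  have left0: "lpart (w i) = rep (int (length (lpart (w i)))) StE" if "i \<in> {1..n}" "i \<noteq> k" for i
    using only_letter[of "lpart (w i)" StE StS] cnt[OF that(1)] k(3)[OF that] by (simp add: cS_def)
  have right0: "rpart (w i) = rep (int (length (rpart (w i)))) StF" if "i \<in> {1..n}" "i \<noteq> p" for i
    using only_letter[of "rpart (w i)" StF StN] cnt[OF that(1)] p(3)[OF that] by (simp add: cN_def)
  define a0 where "a0 i = int (length (lpart (w i)))" for i
  have plain: "w i = plain_path (a0 i) (int i - 1 - a0 i) \<and> a0 i \<le> int i - 1"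
    if i: "i \<in> {1..n}" "i \<noteq> k" "i \<noteq> p" for i
  proof -
    have w: "w i = plain_path (a0 i) (int (length (rpart (w i))))"
      unfolding plain_path_def a0_def
      using left0[OF i(1,2)] right0[OF i(1,3)] lpart_append_rpart[of "w i"] by simp
    then have "endpoint i (w i) = (a0 i + int (length (rpart (w i))), int i)"
      using plain_path_verts(4)[of "a0 i" "int (length (rpart (w i)))" i] by (simp add: a0_def)
    then have "a0 i + int (length (rpart (w i))) = int i - 1" using ep[OF i(1)] by simp
    then have "int (length (rpart (w i))) = int i - 1 - a0 i" "a0 i \<le> int i - 1" by linarith+
    then show ?thesis using w by simp
  qed
  obtain x y where xy: "lpart (w k) = rep (int x) StE @ [StS] @ rep (int y) StE"
    using letter_once[of "lpart (w k)" StE StS] cnt[OF k(1)] k(2) by (auto simp: cS_def)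
  have jk: "junction k (w k) = (int x + int y, int k - 1)"
    by (simp add: junction_def xy start_def walk_rep)
  have lk: "left_verts k (w k) = {0..int x} \<times> {int k} \<union> {int x..int x + int y} \<times> {int k - 1}"
    by (auto simp: left_verts_def xy start_def walk_rep)
  have jR: "junction i (w i) \<in> right_verts i (w i)" for i
    by (simp add: right_verts_def start_in_walk)
  have k2: "2 \<le> k" and k1: "k - 1 \<in> {1..n}" "k - 1 \<noteq> k" "int (k - 1) = int k - 1"
    using G[OF k(1), of "junction k (w k)"] jR[of k] k(1) by (auto simp: jk in_G_def)
  \<comment> \<open>Otherwise path \<open>k - 1\<close> is plain and its Right part runs along row
    \<open>k - 1\<close> up to abscissa \<open>k - 2\<close>. Disjointness of the Left parts puts
    the S-step of path \<open>k\<close> to the right of the junction of path \<open>k - 1\<close>,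
    so the junction of path \<open>k\<close> would lie on that Right part.\<close>
  have "p \<noteq> k"
  proof
    assume "p = k"
    then have "w (k-1) = plain_path (a0 (k-1)) (int (k-1) - 1 - a0 (k-1))" "a0 (k-1) \<le> int (k-1) - 1"
      using plain[of "k-1"] k1 by auto
    then have v: "left_verts (k-1) (w (k-1)) = {0..a0 (k-1)} \<times> {int k - 1}"
      "right_verts (k-1) (w (k-1)) = {a0 (k-1)..int k - 2} \<times> {int k - 1}"
      using plain_path_verts[of "a0 (k-1)" "int (k-1) - 1 - a0 (k-1)" "k-1"] k1(3)
      by (simp_all add: a0_def)
    have "(int x, int k - 1) \<notin> left_verts (k-1) (w (k-1))"
      using L[OF k1(1) k(1) k1(2)] lk by auto
    then have "a0 (k-1) < int x" unfolding v by auto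
    moreover have "int x + int y \<le> int k - 2"
      using G[OF k(1), of "junction k (w k)"] jR[of k] by (auto simp: jk in_G_def)
    ultimately have "junction k (w k) \<in> right_verts (k-1) (w (k-1))" unfolding v jk by auto
    then show False using R[OF k1(1) k(1) k1(2)] jR by blast
  qed
  have sp: "\<sigma> p = p + 1" using sig_eq[OF p(1)] p(2) k(3)[OF p(1) \<open>p \<noteq> k\<close>] by linarith
  \<comment> \<open>Path \<open>p\<close> ends at height \<open>p + 1\<close>. If path
    \<open>p + 1\<close> had no S-step it would end there as well, against injectivity of
    \<open>\<sigma>\<close>.\<close>
  have pk: "p = k - 1"
  proof (rule ccontr)
    assume "p \<noteq> k - 1"
    have "\<sigma> p \<in> {1..n}" using sig p(1) by (metis bij_betwE)
    then have q: "p + 1 \<in> {1..n}" by (simp add: sp)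
    then have "\<sigma> (p + 1) = p + 1"
      using sig_eq[OF q] p(3)[OF q] k(3)[OF q] \<open>p \<noteq> k - 1\<close> by auto
    then show False using sig q p(1) sp by (auto simp: bij_betw_def dest!: inj_onD[of \<sigma> _ p "p + 1"])
  qed
  obtain s t where st: "rpart (w p) = rep (int s) StF @ [StN] @ rep (int t) StF"
    using letter_once[of "rpart (w p)" StF StN] cnt[OF p(1)] p(2) by (auto simp: cN_def)
  have wp: "w p = up_path (a0 p) (int s) (int t)"
    unfolding up_path_def a0_def using left0[OF p(1) \<open>p \<noteq> k\<close>] st lpart_append_rpart[of "w p"] by simp
  note vp = up_path_verts[of "a0 p" "int s" "int t" p, folded wp]
  have wk: "w k = down_path (int x) (int y) (int (length (rpart (w k))))"
    unfolding down_path_def using right0[OF k(1)] \<open>p \<noteq> k\<close> xy lpart_append_rpart[of "w k"] by simp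
  note vk = down_path_verts[of "int x" "int y" "int (length (rpart (w k)))" k, folded wk]
  have tp: "int t = int k - 2 - a0 p - int s" and a0p: "0 \<le> a0 p"
    using vp(4) ep[OF p(1)] k1(3) by (auto simp: pk a0_def)
  have tk: "int (length (rpart (w k))) = int k - 2 - int x - int y"
    using vk(4) ep[OF k(1)] by auto
  have ax: "a0 p < int x"
  proof -
    have "(int x, int k - 1) \<notin> left_verts p (w p)" using L[OF p(1) k(1) \<open>p \<noteq> k\<close>] lk by auto
    then show ?thesis using vp(1) a0p k1(3) pk by auto
  qed
  have bx: "a0 p + int s < int x + int y"
  proof -
    have "junction k (w k) \<notin> right_verts p (w p)" using R[OF p(1) k(1) \<open>p \<noteq> k\<close>] jR[of k] by blast
    then show ?thesis using vp(3) a0p k1(3) pk ax by (auto simp: jk)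
  qed
  \<comment> \<open>\<open>a0 k\<close> counts the whole Left part of path \<open>k\<close>,
    including the S-step and the steps after it; the table wants only the E-steps before the
    S-step.\<close>
  define a where "a = a0(k := int x)"
  have "valid_table n k a (int y) (int s)"
    unfolding valid_table_def
    using k2 k(1) ax bx tk pk plain by (auto simp: a_def a0_def)
  moreover have "Om = config n k a (int y) (int s)"
  proof (rule config_eqI[OF len])
    fix i assume i: "i \<in> {1..n}"
    consider "i = k" | "i = p" | "i \<noteq> k" "i \<noteq> p" by blast
    then have "w i = config_path k a (int y) (int s) i"
    proof cases
      case 1
      then show ?thesis using wk[unfolded tk] pk k1(2) by (simp add: config_path_def a_def)
    next
      case 2
      then show ?thesis using wp[unfolded tp] pk k1(2) by (simp add: config_path_def a_def)
    next
      case 3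
      then show ?thesis using plain[OF i 3] pk by (simp add: config_path_def a_def)
    qed
    then show "Om ! (i - 1) = config_path k a (int y) (int s) i" by (simp only: w_def)
  qed
  ultimately show thesis using that by blast
qed

text \<open>\<open>rho\<close> reverses each row of the region. In row \<open>k - 1\<close> this
  also reverses the order of the two junctions, so they exchange their roles: the junction of path
  \<open>k\<close> becomes that of path \<open>k - 1\<close> in the dual and conversely. This
  explains why the formulas for \<open>a' (k - 1)\<close> and \<open>b'\<close> mix the two
  paths.\<close>

lemma dual_config:
  assumes v: "valid_table n k a b \<beta>" and v': "valid_table n k a' b' \<beta>'"
    and a: "\<And>i. i \<in> {1..n} \<Longrightarrow> i \<noteq> k - 1 \<Longrightarrow> a' i = int i - 1 - a i"
    and ak: "a' (k - 1) = int k - 2 - a k - b"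
    and b: "b' = a k - 1 - a (k - 1)"
    and beta: "\<beta>' = a k + b - a (k - 1) - \<beta> - 1"
  shows "dual n (config n k a b \<beta>) = config n k a' b' \<beta>'"
proof -
  note d = validD(1,2,5-)[OF v] validD(1,2,5-)[OF v']
  have kn: "k \<in> {1..n}" "k \<noteq> k - 1" and k1: "k - 1 \<in> {1..n}" "int (k - 1) = int k - 1" using d by auto
  have a'k: "a' k = int k - 1 - a k" using a kn by blast
  have S: "{1..n} - {k} = insert (k - 1) ({1..n} - {k, k - 1})" using k1 kn by auto
  have "(\<lambda>i. (a' i, int i)) ` ({1..n} - {k, k - 1}) = rho ` (\<lambda>i. (a i, int i)) ` ({1..n} - {k, k - 1})"
    unfolding image_image by (rule image_cong) (auto simp: a rho_def)
  \<comment> \<open>For row \<open>k - 1\<close> the crossed identities are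
    \<open>a' (k - 1) = int k - 2 - (a k + b)\<close> and
    \<open>a' k + b' = int k - 2 - a (k - 1)\<close>.\<close>
  then have J: "junctions n (config n k a' b' \<beta>') = rho ` junctions n (config n k a b \<beta>)"
    unfolding junctions_config[OF v] junctions_config[OF v'] S image_insert
    using k1(2) by (simp add: rho_def a'k ak[unfolded One_nat_def] b insert_commute algebra_simps)
  have M: "M1 n (config n k a' b' \<beta>') \<and> junctions n (config n k a' b' \<beta>') = rho ` junctions n (config n k a b \<beta>) \<and>
      S_start n (config n k a' b' \<beta>') = rho (S_start n (config n k a b \<beta>)) \<and>
      N_end n (config n k a' b' \<beta>') = rho (N_end n (config n k a b \<beta>))"
    using M1_config[OF v'] J
    unfolding S_start_config[OF v] S_start_config[OF v'] N_end_config[OF v] N_end_config[OF v']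
    by (simp add: rho_def a'k ak[unfolded One_nat_def] beta[unfolded One_nat_def])
  show ?thesis unfolding dual_def
  proof (rule the_equality, goal_cases)
    case 1
    show ?case by (rule M)
  next
    case (2 Om')
    then obtain K A B C where "valid_table n K A B C" "Om' = config n K A B C"
      using M1_imp_config by metis
    then show ?case
      using valid_table_unique[OF _ v'] 2 M by metis
  qed
qed


section \<open>Alternating sign matrices with one negative entry\<close>

lemma alternating_all_one:
  assumes "alternating xs" "\<forall>x\<in>set xs. x = 1"
  shows "xs = [1]"
proof (cases xs)
  case (Cons x ys)
  then show ?thesis
  proof (cases ys)
    case (Cons y zs)
    with \<open>xs = x # ys\<close> assms have "xs ! Suc 0 = - (xs ! 0)" unfolding alternating_def by auto
    then show ?thesis using assms(2) Cons \<open>xs = x # ys\<close> by auto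
  qed (use assms Cons in auto)
qed (use assms in \<open>simp add: alternating_def\<close>)

lemma alternating_one_neg:
  assumes "alternating (ys @ [-1] @ zs)" "\<forall>x\<in>set ys \<union> set zs. x = 1"
  shows "ys = [1]" "zs = [1]"
proof -
  have step: "Suc p < length (ys @ [-1] @ zs) \<Longrightarrow> (ys @ [-1] @ zs) ! Suc p = - ((ys @ [-1] @ zs) ! p)" for p
    using assms(1) unfolding alternating_def by blast
  have "ys \<noteq> []" using assms(1) by (auto simp: alternating_def)
  then obtain y ys' where y: "ys = y # ys'" by (cases ys) auto
  have "ys' = []"
  proof (cases ys')
    case (Cons a as)
    then show ?thesis using step[of 0] y assms(2) by auto
  qed
  then show ys: "ys = [1]" using y assms(2) by simp
  have "zs \<noteq> []" using assms(1) by (auto simp: alternating_def)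
  then obtain z zs' where z: "zs = z # zs'" by (cases zs) auto
  have "zs' = []"
  proof (cases zs')
    case (Cons a as)
    then show ?thesis using step[of 2] z ys assms(2) by (auto simp: numeral_2_eq_2)
  qed
  then show "zs = [1]" using z assms(2) by simp
qed

lemma filter_nonzero_eq_single:
  fixes f :: "nat \<Rightarrow> int"
  assumes "\<And>j. a \<le> j \<Longrightarrow> j < b \<Longrightarrow> f j = 0 \<or> f j = 1"
  shows "filter (\<lambda>x. x \<noteq> 0) (map f [a..<b]) = [1] \<longleftrightarrow> (\<exists>!j. a \<le> j \<and> j < b \<and> f j = 1)"
proof -
  let ?js = "filter (\<lambda>j. f j \<noteq> 0) [a..<b]"
  have S: "set ?js = {j. a \<le> j \<and> j < b \<and> f j = 1}" using assms by fastforce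
  have "filter (\<lambda>x. x \<noteq> 0) (map f [a..<b]) = map f ?js" by (simp add: filter_map comp_def)
  also have "map f ?js = [1] \<longleftrightarrow> length ?js = 1"
  proof
    assume "length ?js = 1"
    then obtain j where "?js = [j]" by (auto simp: length_Suc_conv)
    then show "map f ?js = [1]" using S by auto
  qed (metis length_map length_Cons list.size(3) One_nat_def)
  also have "length ?js = card (set ?js)" by (rule distinct_card[symmetric]) simp
  also have "\<dots> = 1 \<longleftrightarrow> (\<exists>j. \<forall>j'. j' \<in> set ?js \<longleftrightarrow> j' = j)"
    by (simp add: card_1_singleton_iff set_eq_iff del: set_filter)
  also have "\<dots> \<longleftrightarrow> (\<exists>!j. j \<in> set ?js)" by metis
  finally show ?thesis unfolding S by simp
qed

lemma filter_nonzero_all_one: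
  fixes f :: "nat \<Rightarrow> int"
  assumes "\<And>j. a \<le> j \<Longrightarrow> j < b \<Longrightarrow> f j = 0 \<or> f j = 1"
  shows "\<forall>x\<in>set (filter (\<lambda>x. x \<noteq> 0) (map f [a..<b])). x = 1"
  using assms by fastforce

lemma alternating_line_no_neg:
  fixes f :: "nat \<Rightarrow> int"
  assumes "\<And>j. f j = 0 \<or> f j = 1"
  shows "alternating (filter (\<lambda>x. x \<noteq> 0) (map f [1..<n+1])) \<longleftrightarrow> (\<exists>!j. 1 \<le> j \<and> j \<le> n \<and> f j = 1)"
proof -
  have "alternating (filter (\<lambda>x. x \<noteq> 0) (map f [1..<n+1])) \<longleftrightarrow> filter (\<lambda>x. x \<noteq> 0) (map f [1..<n+1]) = [1]"
  proof
    assume "filter (\<lambda>x. x \<noteq> 0) (map f [1..<n+1]) = [1]"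
    moreover have "alternating [1]" by (simp add: alternating_def)
    ultimately show "alternating (filter (\<lambda>x. x \<noteq> 0) (map f [1..<n+1]))" by metis
  qed (use alternating_all_one[OF _ filter_nonzero_all_one[of 1 "n+1" f]] assms in blast)
  also have "\<dots> \<longleftrightarrow> (\<exists>!j. 1 \<le> j \<and> j < n+1 \<and> f j = 1)"
    by (rule filter_nonzero_eq_single) (rule assms)
  finally show ?thesis by (simp add: less_Suc_eq_le del: upt_Suc)
qed

lemma alternating_line_one_neg:
  fixes f :: "nat \<Rightarrow> int"
  assumes "1 \<le> m" "m \<le> n" "f m = -1" "\<And>j. j \<noteq> m \<Longrightarrow> f j = 0 \<or> f j = 1"
  shows "alternating (filter (\<lambda>x. x \<noteq> 0) (map f [1..<n+1])) \<longleftrightarrow>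
    (\<exists>!j. 1 \<le> j \<and> j < m \<and> f j = 1) \<and> (\<exists>!j. m < j \<and> j \<le> n \<and> f j = 1)"
proof -
  let ?F = "\<lambda>a b. filter (\<lambda>x. x \<noteq> 0) (map f [a..<b])"
  have "[1..<n+1] = [1..<m] @ [m] @ [Suc m..<n+1]"
  proof -
    have "[1..<n+1] = [1..<m] @ [m..<n+1]" using upt_add_eq_append[of 1 m "n+1-m"] assms by simp
    also have "[m..<n+1] = m # [Suc m..<n+1]" using assms by (simp add: upt_conv_Cons del: upt_Suc)
    finally show ?thesis by simp
  qed
  then have F: "?F 1 (n+1) = ?F 1 m @ [-1] @ ?F (Suc m) (n+1)"
    using assms(3) by (simp del: upt_Suc)
  have 1: "\<forall>x\<in>set (?F 1 m) \<union> set (?F (Suc m) (n+1)). x = 1"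
  proof -
    have "\<forall>x\<in>set (?F 1 m). x = 1" by (rule filter_nonzero_all_one) (rule assms(4), simp)
    moreover have "\<forall>x\<in>set (?F (Suc m) (n+1)). x = 1" by (rule filter_nonzero_all_one) (rule assms(4), simp)
    ultimately show ?thesis by blast
  qed
  have "alternating (?F 1 (n+1)) \<longleftrightarrow> ?F 1 m = [1] \<and> ?F (Suc m) (n+1) = [1]"
  proof
    assume "alternating (?F 1 (n+1))"
    then show "?F 1 m = [1] \<and> ?F (Suc m) (n+1) = [1]"
      unfolding F using alternating_one_neg[OF _ 1] by blast
  next
    assume "?F 1 m = [1] \<and> ?F (Suc m) (n+1) = [1]"
    then have "?F 1 (n+1) = [1, -1, 1]" unfolding F by (simp del: upt_Suc)
    moreover have "alternating [1, -1, 1]"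
      by (auto simp: alternating_def nth_Cons' less_Suc_eq)
    ultimately show "alternating (?F 1 (n+1))" by metis
  qed
  also have "?F 1 m = [1] \<longleftrightarrow> (\<exists>!j. 1 \<le> j \<and> j < m \<and> f j = 1)"
    by (rule filter_nonzero_eq_single) (rule assms(4), simp)
  also have "?F (Suc m) (n+1) = [1] \<longleftrightarrow> (\<exists>!j. Suc m \<le> j \<and> j < n+1 \<and> f j = 1)"
    by (rule filter_nonzero_eq_single) (rule assms(4), simp)
  finally show ?thesis by (simp add: less_Suc_eq_le Suc_le_eq del: upt_Suc)
qed

text \<open>Here \<open>k\<close> and \<open>r\<close> are the opening and closing rows, \<open>m\<close> and \<open>c\<close> the opening and closing
  columns, \<open>u\<close> is the row of the lower 1 of the opening column and \<open>l\<close> the column of the left 1 of the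
  closing row.\<close>

locale asm_at =
  fixes n :: nat and A :: mat and k r u l m c :: nat
  assumes bounds: "1 \<le> k" "k < r" "r < u" "u \<le> n" "1 \<le> l" "l < m" "m < c" "c \<le> n"
    and neg: "A r m = -1"
    and nonneg: "(i, j) \<noteq> (r, m) \<Longrightarrow> A i j = 0 \<or> A i j = 1"
    and support: "A i j \<noteq> 0 \<Longrightarrow> i \<in> {1..n} \<and> j \<in> {1..n}"
    and closing_row_ones: "A r j = 1 \<longleftrightarrow> j = l \<or> j = c"
    and opening_col_ones: "A i m = 1 \<longleftrightarrow> i = k \<or> i = u"
    and row_one: "i \<in> {1..n} \<Longrightarrow> i \<noteq> r \<Longrightarrow> \<exists>!j. A i j = 1"
    and col_one: "j \<in> {1..n} \<Longrightarrow> j \<noteq> m \<Longrightarrow> \<exists>!i. A i j = 1"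

text \<open>In a line through the -1, alternation means exactly one 1 on each side of it; every
  other line contains exactly one 1.\<close>

lemma asm1_imp_asm_at:
  assumes "asm1 n A"
  obtains k r u l m c where "asm_at n A k r u l m c"
proof -
  have asm: "is_asm n A" and "card {(i, j). i \<in> {1..n} \<and> j \<in> {1..n} \<and> A i j = -1} = 1"
    using assms by (auto simp: asm1_def)
  then obtain p where "{(i, j). i \<in> {1..n} \<and> j \<in> {1..n} \<and> A i j = -1} = {p}"
    using card_1_singleton_iff[of "{(i, j). i \<in> {1..n} \<and> j \<in> {1..n} \<and> A i j = -1}"] by auto
  then obtain r m where p: "{(i, j). i \<in> {1..n} \<and> j \<in> {1..n} \<and> A i j = -1} = {(r, m)}"
    by (cases p) auto
  then have rm: "r \<in> {1..n}" "m \<in> {1..n}" "A r m = -1" by blast+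
  have supp: "i \<in> {1..n} \<and> j \<in> {1..n}" if "A i j \<noteq> 0" for i j
    using asm that unfolding is_asm_def by blast
  have nn: "A i j = 0 \<or> A i j = 1" if "(i, j) \<noteq> (r, m)" for i j
  proof -
    have "A i j \<in> {-1, 0, 1}" using asm unfolding is_asm_def by blast
    moreover have "A i j \<noteq> -1" using p that supp[of i j] by auto
    ultimately show ?thesis by blast
  qed
  have row: "alternating (filter (\<lambda>x. x \<noteq> 0) (map (A i) [1..<n+1]))" if "i \<in> {1..n}" for i
    using asm that unfolding is_asm_def row_nz_def by blast
  have col: "alternating (filter (\<lambda>x. x \<noteq> 0) (map (\<lambda>i. A i j) [1..<n+1]))" if "j \<in> {1..n}" for j
    using asm that unfolding is_asm_def col_nz_def by blast
  have "(\<exists>!j. 1 \<le> j \<and> j < m \<and> A r j = 1) \<and> (\<exists>!j. m < j \<and> j \<le> n \<and> A r j = 1)"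
    by (rule iffD1[OF alternating_line_one_neg row[OF rm(1)]]) (use rm in simp, use rm in simp, rule rm(3), rule nn, simp)
  then obtain l c where l: "1 \<le> l" "l < m" "A r l = 1" "\<And>j. 1 \<le> j \<Longrightarrow> j < m \<Longrightarrow> A r j = 1 \<Longrightarrow> j = l"
    and c: "m < c" "c \<le> n" "A r c = 1" "\<And>j. m < j \<Longrightarrow> j \<le> n \<Longrightarrow> A r j = 1 \<Longrightarrow> j = c"
    by blast
  have "(\<exists>!i. 1 \<le> i \<and> i < r \<and> A i m = 1) \<and> (\<exists>!i. r < i \<and> i \<le> n \<and> A i m = 1)"
    by (rule iffD1[OF alternating_line_one_neg col[OF rm(2)]]) (use rm in simp, use rm in simp, rule rm(3), rule nn, simp)
  then obtain k u where k: "1 \<le> k" "k < r" "A k m = 1" "\<And>i. 1 \<le> i \<Longrightarrow> i < r \<Longrightarrow> A i m = 1 \<Longrightarrow> i = k"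
    and u: "r < u" "u \<le> n" "A u m = 1" "\<And>i. r < i \<Longrightarrow> i \<le> n \<Longrightarrow> A i m = 1 \<Longrightarrow> i = u"
    by blast
  have "asm_at n A k r u l m c"
  proof
    show "A r j = 1 \<longleftrightarrow> j = l \<or> j = c" for j
    proof
      assume j: "A r j = 1"
      then have "j \<noteq> m" "1 \<le> j" "j \<le> n" using rm(3) supp[of r j] by auto
      then show "j = l \<or> j = c" using l(4)[of j] c(4)[of j] j by linarith
    qed (use l(3) c(3) in auto)
    show "A i m = 1 \<longleftrightarrow> i = k \<or> i = u" for i
    proof
      assume i: "A i m = 1"
      then have "i \<noteq> r" "1 \<le> i" "i \<le> n" using rm(3) supp[of i m] by auto
      then show "i = k \<or> i = u" using k(4)[of i] u(4)[of i] i by linarith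
    qed (use k(3) u(3) in auto)
    show "\<exists>!j. A i j = 1" if "i \<in> {1..n}" "i \<noteq> r" for i
    proof -
      have "\<exists>!j. 1 \<le> j \<and> j \<le> n \<and> A i j = 1"
        by (rule iffD1[OF alternating_line_no_neg row[OF that(1)]]) (rule nn, use that(2) in simp)
      moreover have "A i j = 1 \<Longrightarrow> 1 \<le> j \<and> j \<le> n" for j using supp[of i j] by auto
      ultimately show ?thesis by metis
    qed
    show "\<exists>!i. A i j = 1" if "j \<in> {1..n}" "j \<noteq> m" for j
    proof -
      have "\<exists>!i. 1 \<le> i \<and> i \<le> n \<and> A i j = 1"
        by (rule iffD1[OF alternating_line_no_neg col[OF that(1)]]) (rule nn, use that(2) in simp)
      moreover have "A i j = 1 \<Longrightarrow> 1 \<le> i \<and> i \<le> n" for i using supp[of i j] by auto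
      ultimately show ?thesis by metis
    qed
  qed (fact k u l c rm nn supp)+
  then show thesis by (rule that)
qed

context asm_at
begin

lemma in_range: "k \<in> {1..n}" "r \<in> {1..n}" "u \<in> {1..n}" "l \<in> {1..n}" "m \<in> {1..n}" "c \<in> {1..n}"
  using bounds by auto

lemma ones: "A r l = 1" "A r c = 1" "A k m = 1" "A u m = 1"
  using closing_row_ones opening_col_ones by auto

lemma neg_iff: "A i j = -1 \<longleftrightarrow> i = r \<and> j = m"
  using neg nonneg[of i j] by (cases "(i, j) = (r, m)") auto

lemma row_unique: "i \<noteq> r \<Longrightarrow> A i j = 1 \<Longrightarrow> A i j' = 1 \<Longrightarrow> j = j'"
  using row_one[of i] support[of i j] by auto

lemma col_unique: "j \<noteq> m \<Longrightarrow> A i j = 1 \<Longrightarrow> A i' j = 1 \<Longrightarrow> i = i'"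
  using col_one[of j] support[of i j] by auto

text \<open>Converse of \<open>asm1_imp_asm_at\<close>. The neutral partner is constructed entry by
  entry and only checked against the locale; this makes it an ASM again.\<close>

lemma is_asm1: "asm1 n A"
proof -
  have "{(i, j). i \<in> {1..n} \<and> j \<in> {1..n} \<and> A i j = -1} = {(r, m)}"
    using in_range by (auto simp: neg_iff)
  moreover have "is_asm n A"
    unfolding is_asm_def
  proof (intro conjI allI impI ballI)
    show "A i j \<in> {-1, 0, 1}" for i j using neg nonneg[of i j] by (cases "(i, j) = (r, m)") auto
    show "A i j = 0" if "\<not> (i \<in> {1..n} \<and> j \<in> {1..n})" for i j using support that by blast
    show "alternating (row_nz n A i)" if i: "i \<in> {1..n}" for i
    proof (cases "i = r")
      case True
      have "\<exists>!j. 1 \<le> j \<and> j < m \<and> A r j = 1" using bounds closing_row_ones by (intro ex1I[of _ l]) auto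
      moreover have "\<exists>!j. m < j \<and> j \<le> n \<and> A r j = 1" using bounds closing_row_ones by (intro ex1I[of _ c]) auto
      ultimately show ?thesis
        unfolding row_nz_def True
        by (intro iffD2[OF alternating_line_one_neg[of m]] conjI nonneg neg) (use in_range in auto)
    next
      case False
      then have "\<exists>!j. 1 \<le> j \<and> j \<le> n \<and> A i j = 1"
        using row_one[OF i False] support[of i] by (metis atLeastAtMost_iff zero_neq_one)
      then show ?thesis
        unfolding row_nz_def by (intro iffD2[OF alternating_line_no_neg] nonneg) (use False in auto)
    qed
    show "alternating (col_nz n A j)" if j: "j \<in> {1..n}" for j
    proof (cases "j = m")
      case True
      have "\<exists>!i. 1 \<le> i \<and> i < r \<and> A i m = 1" using bounds opening_col_ones by (intro ex1I[of _ k]) auto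
      moreover have "\<exists>!i. r < i \<and> i \<le> n \<and> A i m = 1" using bounds opening_col_ones by (intro ex1I[of _ u]) auto
      ultimately show ?thesis
        unfolding col_nz_def True
        by (intro iffD2[OF alternating_line_one_neg[of r]] conjI nonneg neg) (use in_range in auto)
    next
      case False
      then have "\<exists>!i. 1 \<le> i \<and> i \<le> n \<and> A i j = 1"
        using col_one[OF j False] support[of _ j] by (metis atLeastAtMost_iff zero_neq_one)
      then show ?thesis
        unfolding col_nz_def by (intro iffD2[OF alternating_line_no_neg] nonneg) (use False in auto)
    qed
  qed
  ultimately show ?thesis by (simp add: asm1_def)
qed

lemma minus_pos_eq: "minus_pos n A = (r, m)"
  unfolding minus_pos_def using in_range by (intro the_equality) (auto simp: neg_iff)

lemma opening_col_eq: "opening_col n A = m" and closing_row_eq: "closing_row n A = r"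
  by (simp_all add: opening_col_def closing_row_def minus_pos_eq)

lemma opening_row_eq: "opening_row n A = k"
  unfolding opening_row_def opening_col_eq closing_row_eq
  using bounds by (intro the_equality) (auto simp: opening_col_ones)

lemma closing_col_eq: "closing_col n A = c"
  unfolding closing_col_def opening_col_eq closing_row_eq
  using bounds by (intro the_equality) (auto simp: closing_row_ones)

lemmas frame_eqs = opening_col_eq closing_row_eq opening_row_eq closing_col_eq

lemma one_col_eq: "i \<noteq> r \<Longrightarrow> A i j = 1 \<Longrightarrow> one_col A i = j"
  unfolding one_col_def using row_unique by (intro the_equality) auto

lemma one_col_one: "i \<in> {1..n} \<Longrightarrow> i \<noteq> r \<Longrightarrow> A i (one_col A i) = 1"
  using row_one[of i] one_col_eq[of i] by auto

text \<open>Without enclosed rows the first row below the opening row is the closing row, so the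
  leading 1 is the left 1 of the closing row.\<close>

lemma leading_col_eq:
  assumes "r = Suc k"
  shows "leading_col n A = l"
proof -
  have "leading_row n A = r"
    unfolding leading_row_def frame_eqs
    using bounds ones assms by (intro Least_equality) auto
  then show ?thesis
    unfolding leading_col_def frame_eqs
    using bounds by (intro the_equality) (auto simp: closing_row_ones)
qed

end

lemma reflect_flip: "j \<in> {1..n} \<Longrightarrow> reflect n A i (n + 1 - j) = A i j"
  by (auto simp: reflect_def)

context asm_at
begin

lemma reflect_asm_at: "asm_at n (reflect n A) k r u (n + 1 - c) (n + 1 - m) (n + 1 - l)"
proof
  show "reflect n A r (n + 1 - m) = - 1" using neg reflect_flip[OF in_range(5)] by simp
  show "reflect n A i j = 0 \<or> reflect n A i j = 1" if "(i, j) \<noteq> (r, n + 1 - m)" for i j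
  proof (cases "j \<in> {1..n}")
    case True
    then have "(i, n + 1 - j) \<noteq> (r, m)" using that by auto
    then show ?thesis using nonneg by (simp add: reflect_def)
  qed (auto simp: reflect_def)
  show "i \<in> {1..n} \<and> j \<in> {1..n}" if "reflect n A i j \<noteq> 0" for i j
    using that support[of i "n + 1 - j"] by (auto simp: reflect_def split: if_splits)
  show "reflect n A r j = 1 \<longleftrightarrow> j = n + 1 - c \<or> j = n + 1 - l" for j
    using bounds closing_row_ones[of "n + 1 - j"] by (auto simp: reflect_def)
  show "reflect n A i (n + 1 - m) = 1 \<longleftrightarrow> i = k \<or> i = u" for i
    using bounds opening_col_ones[of i] by (auto simp: reflect_def)
  show "\<exists>!j. reflect n A i j = 1" if i: "i \<in> {1..n}" "i \<noteq> r" for i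
  proof -
    obtain j where j: "A i j = 1" "j \<in> {1..n}" using row_one[OF i] support[of i] by (metis zero_neq_one)
    show ?thesis
    proof (rule ex1I[of _ "n + 1 - j"])
      show "reflect n A i (n + 1 - j) = 1" using j by (simp only: reflect_flip)
      fix j' assume "reflect n A i j' = 1"
      then have "A i (n + 1 - j') = 1" "j' \<in> {1..n}" by (auto simp: reflect_def split: if_splits)
      then show "j' = n + 1 - j" using row_unique[OF i(2) j(1), of "n + 1 - j'"] j(2) by auto
    qed
  qed
  show "\<exists>!i. reflect n A i j = 1" if "j \<in> {1..n}" "j \<noteq> n + 1 - m" for j
  proof -
    have "n + 1 - j \<in> {1..n}" "n + 1 - j \<noteq> m" using that bounds by auto
    then have "\<exists>!i. A i (n + 1 - j) = 1" by (rule col_one)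
    then show ?thesis using that(1) by (simp add: reflect_def)
  qed
qed (use bounds in auto)

lemma reflect_reflect: "reflect n (reflect n A) = A"
  using support by (fastforce simp: reflect_def fun_eq_iff)

end

section \<open>Cell sums, reflection and suffix sums of columns\<close>

lemma cell_sum_eq: "cell_sum A R C = (\<Sum>j\<in>C. \<Sum>i\<in>R. A i j)"
  unfolding cell_sum_def sum.swap[of _ R] sum.cartesian_product ..

lemma cell_sum_eq': "cell_sum A R C = (\<Sum>i\<in>R. \<Sum>j\<in>C. A i j)"
  unfolding cell_sum_def sum.cartesian_product ..

lemma cell_sum_reflect:
  assumes "C \<subseteq> {1..n}"
  shows "cell_sum (reflect n A) R ((\<lambda>j. n + 1 - j) ` C) = cell_sum A R C"
proof -
  have "inj_on (\<lambda>j. n + 1 - j) C" using assms by (auto simp: inj_on_def subset_iff)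
  moreover have "reflect n A i (n + 1 - j) = A i j" if "j \<in> C" for i j
    using that assms by (auto simp: reflect_def subset_iff)
  ultimately show ?thesis unfolding cell_sum_eq by (simp add: sum.reindex)
qed

lemma cell_sum_reflect_between:
  assumes "y \<le> n"
  shows "cell_sum (reflect n A) R {n + 1 - y<..<n + 1 - x} = cell_sum A R {x<..<y}"
proof -
  have "z \<in> (\<lambda>j. n + 1 - j) ` {x<..<y}" if "z \<in> {n + 1 - y<..<n + 1 - x}" for z
    using that assms by (intro image_eqI[of _ _ "n + 1 - z"]) auto
  then have flip: "(\<lambda>j. n + 1 - j) ` {x<..<y} = {n + 1 - y<..<n + 1 - x}" using assms by auto
  have "{x<..<y} \<subseteq> {1..n}" using assms by auto
  from cell_sum_reflect[OF this] show ?thesis unfolding flip .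
qed

context asm_at
begin

lemma row_sum: "i \<in> {1..n} \<Longrightarrow> (\<Sum>j\<in>{1..n}. A i j) = 1"
proof (cases "i = r")
  case True
  have "A r j = (if j = l then 1 else 0) + (if j = c then 1 else 0) - (if j = m then 1 else 0)" for j
    using closing_row_ones[of j] nonneg[of r j] neg bounds by auto
  then show ?thesis using in_range by (simp add: True sum.distrib sum_subtractf)
next
  case False
  assume i: "i \<in> {1..n}"
  have "A i j = (if j = one_col A i then 1 else 0)" for j
  proof (cases "A i j = 1")
    case True
    then show ?thesis using one_col_eq[OF False] by simp
  next
    assume "A i j \<noteq> 1"
    moreover from this have "A i j = 0" using nonneg[of i j] False by simp
    ultimately show ?thesis using one_col_one[OF i False] by metis
  qed
  moreover have "one_col A i \<in> {1..n}" using support one_col_one[OF i False] by (metis zero_neq_one)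
  ultimately show ?thesis by simp
qed

lemma opening_col_suffix_sum:
  "(\<Sum>i\<in>{x<..n}. A i m) = (if x < k then 1 else 0) + (if x < u then 1 else 0) - (if x < r then 1 else 0)"
proof -
  have "A i m = (if i = k then 1 else 0) + (if i = u then 1 else 0) - (if i = r then 1 else 0)" for i
    using opening_col_ones[of i] nonneg[of i m] neg bounds by auto
  then show ?thesis using in_range by (simp add: sum.distrib sum_subtractf)
qed

text \<open>A suffix of the opening column that contains the -1 in row \<open>r\<close> also
  contains the lower 1 in row \<open>u > r\<close>.\<close>

lemma col_suffix_nonneg: "0 \<le> (\<Sum>i\<in>{x<..n}. A i j)"
proof (cases "j = m")
  case True
  then show ?thesis using bounds by (simp add: opening_col_suffix_sum)
next
  case False
  have "0 \<le> A i j" for i using nonneg[of i j] False by auto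
  then show ?thesis by (simp add: sum_nonneg)
qed

text \<open>In the opening column, below the upper 1, the -1 and the lower 1 cancel. Hence the
  column of a 1 contributes nothing below that 1, and the counts to its left and to its right are
  complementary.\<close>

lemma col_suffix_zero:
  assumes "A x j = 1"
  shows "(\<Sum>i\<in>{x<..n}. A i j) = 0"
proof (cases "j = m")
  case True
  then show ?thesis using assms bounds opening_col_ones[of x] by (auto simp: opening_col_suffix_sum)
next
  case False
  have "A i j = 0" if "x < i" for i using nonneg[of i j] False col_unique[OF False assms, of i] that by auto
  then show ?thesis by (auto intro: sum.neutral)
qed

lemma cell_sum_suffix_nonneg: "0 \<le> cell_sum A {x<..n} C"
  unfolding cell_sum_eq by (rule sum_nonneg) (rule col_suffix_nonneg)

lemma suffix_total: "x \<le> n \<Longrightarrow> cell_sum A {x<..n} {1..n} = int n - int x"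
  unfolding cell_sum_eq' using row_sum by (simp add: of_nat_diff)

lemma cell_sum_split:
  assumes "j \<in> C" "finite C"
  shows "cell_sum A R C = cell_sum A R {i \<in> C. i < j} + (\<Sum>i\<in>R. A i j) + cell_sum A R {i \<in> C. j < i}"
proof -
  have "C = insert j ({i \<in> C. i < j} \<union> {i \<in> C. j < i})" using assms(1) by auto
  moreover have "sum f (insert j ({i \<in> C. i < j} \<union> {i \<in> C. j < i})) =
     f j + (sum f {i \<in> C. i < j} + sum f {i \<in> C. j < i})" for f :: "nat \<Rightarrow> int"
    using assms(2) by (subst sum.insert, simp, simp, subst sum.union_disjoint) auto
  ultimately show ?thesis unfolding cell_sum_eq by (metis (no_types, lifting) add.assoc add.commute)
qed

lemma left_plus_right:
  assumes "x \<le> n" "j \<in> {1..n}"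
  shows "cell_sum A {x<..n} {1..<j} + (\<Sum>i\<in>{x<..n}. A i j) + cell_sum A {x<..n} {j<..n} = int n - int x"
proof -
  have "{i \<in> {1..n}. i < j} = {1..<j}" "{i \<in> {1..n}. j < i} = {j<..n}" using assms(2) by auto
  then show ?thesis using cell_sum_split[of j "{1..n}" "{x<..n}"] suffix_total[OF assms(1)] assms(2) by simp
qed

definition inv_col :: "nat \<Rightarrow> nat" where
  "inv_col x = (if x = r then l else one_col A x)"

definition inv_entry :: "nat \<Rightarrow> int" where
  "inv_entry i = cell_sum A {n + 1 - i<..n} {1..<inv_col (n + 1 - i)}"

lemma gen_inv_table_eq: "gen_inv_table n (A, E) = (n + 1 - k, inv_entry, cval n A, E + ell n A)"
proof -
  have "(LEAST j. A r j = 1) = l" by (rule Least_equality) (use closing_row_ones bounds in auto)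
  then show ?thesis
    by (auto simp: gen_inv_table_def Let_def frame_eqs inv_entry_def inv_col_def fun_eq_iff)
qed

end

section \<open>Inversion tables of neutral matrices\<close>

locale neutral_asm_at = asm_at +
  assumes neutral: "r = Suc k"
begin

text \<open>The leading cell starts at the closing row, the closing cell one row lower. The closing
  row vanishes strictly between \<open>l\<close> and \<open>m\<close>, so both can be taken below
  the closing row, which makes \<open>ell\<close> and \<open>cval\<close> mirror images of each
  other.\<close>

lemma ell_eq: "ell n A = cell_sum A {r<..n} {l<..<m}"
proof -
  have "{k<..n} = insert r {r<..n}" using neutral bounds by auto
  moreover have "A r j = 0" if "j \<in> {l<..<m}" for j
    using that nonneg[of r j] closing_row_ones[of j] bounds by auto
  ultimately have "(\<Sum>i\<in>{k<..n}. A i j) = (\<Sum>i\<in>{r<..n}. A i j)" if "j \<in> {l<..<m}" for j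
    using that by simp
  then show ?thesis
    unfolding ell_def frame_eqs leading_col_eq[OF neutral] cell_sum_eq by (rule sum.cong[OF refl])
qed

lemma cval_eq: "cval n A = cell_sum A {r<..n} {m<..<c}"
  by (simp add: cval_def frame_eqs)

lemma ell_nonneg: "0 \<le> ell n A" and cval_nonneg: "0 \<le> cval n A"
  unfolding ell_eq cval_eq by (rule cell_sum_suffix_nonneg)+

text \<open>The index \<open>n - k\<close> belongs to the closing row, since
  \<open>n + 1 - (n - k) = Suc k = r\<close>; it is the index written \<open>k - 1\<close> in a
  table.\<close>

lemma inv_entry_closing: "inv_entry (n - k) = cell_sum A {r<..n} {1..<l}"
proof -
  have "n + 1 - (n - k) = r" using bounds neutral by simp
  then show ?thesis by (simp only: inv_entry_def inv_col_def if_True refl)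
qed

lemma below_closing_left: "cell_sum A {r<..n} {1..<m} = cell_sum A {r<..n} {1..<l} + ell n A"
proof -
  have "{i \<in> {1..<m}. i < l} = {1..<l}" "{i \<in> {1..<m}. l < i} = {l<..<m}" using bounds by auto
  then show ?thesis
    using cell_sum_split[of l "{1..<m}" "{r<..n}"] bounds col_suffix_zero[OF ones(1)] by (simp add: ell_eq)
qed

lemma below_closing_right: "cell_sum A {r<..n} {m<..n} = cval n A + cell_sum A {r<..n} {c<..n}"
proof -
  have "{i \<in> {m<..n}. i < c} = {m<..<c}" "{i \<in> {m<..n}. c < i} = {c<..n}" using bounds by auto
  then show ?thesis
    using cell_sum_split[of c "{m<..n}" "{r<..n}"] bounds col_suffix_zero[OF ones(2)] by (simp add: cval_eq)
qed

text \<open>Below the closing row the columns \<open>l\<close> and \<open>c\<close> sum to 0 and the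
  opening column sums to 1, its lower 1; the other columns form the four cells on the left-hand
  side.\<close>

lemma below_closing_total:
  "inv_entry (n - k) + ell n A + 1 + cval n A + cell_sum A {r<..n} {c<..n} = int n - int r"
  using left_plus_right[OF _ in_range(5), of r] bounds
  unfolding below_closing_left below_closing_right inv_entry_closing opening_col_suffix_sum by simp

text \<open>The 1 of the opening row is in column \<open>m\<close>. To its left, the closing row
  adds its left 1, and the rows below split at column \<open>l\<close> into the entry of the closing
  row and the leading cell. This is the origin of the dual formula for \<open>b\<close>, which
  equals \<open>ell\<close> before reflection.\<close>

lemma inv_entry_opening: "inv_entry (n + 1 - k) = inv_entry (n - k) + ell n A + 1"
proof -
  have R: "{k<..n} = insert r {r<..n}" using neutral bounds by auto
  have "A r j = (if j = l then 1 else 0)" if "j \<in> {1..<m}" for j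
    using that nonneg[of r j] closing_row_ones[of j] bounds by auto
  then have "(\<Sum>j\<in>{1..<m}. A r j) = 1" using bounds by (simp add: sum.delta)
  then have "cell_sum A {k<..n} {1..<m} = 1 + cell_sum A {r<..n} {1..<m}"
    unfolding cell_sum_eq' R by simp
  moreover have "inv_entry (n + 1 - k) = cell_sum A {k<..n} {1..<m}"
    using bounds one_col_eq[of k m] ones by (simp add: inv_entry_def inv_col_def)
  ultimately show ?thesis unfolding below_closing_left inv_entry_closing by simp
qed

lemma inv_entry_complement:
  assumes "i \<in> {1..n}" "i \<noteq> n - k"
  shows "inv_entry i + cell_sum A {n + 1 - i<..n} {one_col A (n + 1 - i)<..n} = int i - 1"
proof -
  have x: "n + 1 - i \<in> {1..n}" "n + 1 - i \<noteq> r" using assms neutral bounds by auto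
  note one = one_col_one[OF x]
  have "one_col A (n + 1 - i) \<in> {1..n}" using support one by (metis zero_neq_one)
  then show ?thesis
    using left_plus_right[of "n + 1 - i" "one_col A (n + 1 - i)"] x col_suffix_zero[OF one] assms(1)
    by (simp add: inv_entry_def inv_col_def of_nat_diff)
qed

text \<open>By \<open>inv_entry_opening\<close>, the second disjointness condition is exactly
  \<open>E \<le> cval n A\<close>, and nonnegativity of \<open>\<beta>\<close> is exactly
  \<open>- ell n A \<le> E\<close>; the bound on \<open>a k + b\<close> is
  \<open>below_closing_total\<close> with the last cell dropped.\<close>

lemma valid_inv_table:
  assumes "- ell n A \<le> E" "E \<le> cval n A"
  shows "valid_table n (n + 1 - k) inv_entry (cval n A) (E + ell n A)"
proof -
  have k1: "n + 1 - k - 1 = n - k" by simp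
  have nn: "0 \<le> inv_entry i" for i unfolding inv_entry_def by (rule cell_sum_suffix_nonneg)
  have "0 \<le> cell_sum A {r<..n} {c<..n}" by (rule cell_sum_suffix_nonneg)
  then have Y: "inv_entry (n - k) + ell n A + 1 + cval n A \<le> int n - int r"
    using below_closing_total by linarith
  have up: "inv_entry i \<le> int i - 1" if "i \<in> {1..n}" "i \<noteq> n - k" for i
    using inv_entry_complement[OF that] cell_sum_suffix_nonneg[of "n + 1 - i"] by (metis add.commute add_le_cancel_right add_0 le_add_same_cancel2 order_trans)
  show ?thesis
    unfolding valid_table_def k1 inv_entry_opening
    using bounds neutral nn up Y ell_nonneg cval_nonneg assms by auto
qed

lemma reflect_neutral_asm_at:
  "neutral_asm_at n (reflect n A) k r u (n + 1 - c) (n + 1 - m) (n + 1 - l)"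
  using reflect_asm_at neutral by (simp add: neutral_asm_at_def neutral_asm_at_axioms_def)

lemma ell_reflect: "ell n (reflect n A) = cval n A"
  unfolding neutral_asm_at.ell_eq[OF reflect_neutral_asm_at] cval_eq
  by (rule cell_sum_reflect_between) (use bounds in auto)

lemma cval_reflect: "cval n (reflect n A) = ell n A"
  unfolding neutral_asm_at.cval_eq[OF reflect_neutral_asm_at] ell_eq
  by (rule cell_sum_reflect_between) (use bounds in auto)

end

text \<open>Reflection turns the count to the left of a 1 into the count to its right, which
  \<open>inv_entry_complement\<close> converts back into \<open>i - 1\<close> minus the old entry.
  The closing row behaves differently, because its leftmost 1 after reflection is the old closing 1;
  there \<open>below_closing_total\<close> is used instead.\<close>

lemma dual_neutral:
  assumes "neutral_asm_at n A k r u l m c" "- ell n A \<le> E" "E \<le> cval n A"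
  shows "dual n (Phi n (A, E)) = Phi n (reflect n A, - E)"
proof -
  interpret N: neutral_asm_at n A k r u l m c by fact
  interpret R: neutral_asm_at n "reflect n A" k r u "n + 1 - c" "n + 1 - m" "n + 1 - l"
    by (rule N.reflect_neutral_asm_at)
  note b = N.bounds
  have flip': "(\<lambda>j. n + 1 - j) ` {x<..n} = {1..<n + 1 - x}" for x
  proof -
    have "z \<in> (\<lambda>j. n + 1 - j) ` {x<..n}" if "z \<in> {1..<n + 1 - x}" for z
      using that by (intro image_eqI[of _ _ "n + 1 - z"]) auto
    then show ?thesis by auto
  qed
  have right: "cell_sum (reflect n A) {x<..n} {1..<n + 1 - j} = cell_sum A {x<..n} {j<..n}" for x j
  proof -
    have "{j<..n} \<subseteq> {1..n}" by auto
    from cell_sum_reflect[OF this] show ?thesis unfolding flip' .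
  qed
  note ell = N.ell_reflect and cval = N.cval_reflect
  have K: "n + 1 - k - 1 = n - k" by simp
  have closing: "R.inv_entry (n - k) = cell_sum A {r<..n} {c<..n}"
    unfolding R.inv_entry_closing right ..
  have other: "R.inv_entry i = int i - 1 - N.inv_entry i" if i: "i \<in> {1..n}" "i \<noteq> n - k" for i
  proof -
    have x: "n + 1 - i \<in> {1..n}" "n + 1 - i \<noteq> r" using i N.neutral b by auto
    note one = N.one_col_one[OF x]
    have "one_col A (n + 1 - i) \<in> {1..n}" using N.support one by (metis zero_neq_one)
    then have "reflect n A (n + 1 - i) (n + 1 - one_col A (n + 1 - i)) = 1"
      using one by (simp only: reflect_flip)
    then have "one_col (reflect n A) (n + 1 - i) = n + 1 - one_col A (n + 1 - i)"
      using R.one_col_eq[OF x(2)] by blast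
    then have "R.inv_entry i = cell_sum A {n + 1 - i<..n} {one_col A (n + 1 - i)<..n}"
      using x(2) by (simp only: R.inv_entry_def R.inv_col_def right if_False)
    then show ?thesis using N.inv_entry_complement[OF i] by linarith
  qed
  have "dual n (config n (n + 1 - k) N.inv_entry (cval n A) (E + ell n A)) =
    config n (n + 1 - k) R.inv_entry (cval n (reflect n A)) (- E + ell n (reflect n A))"
  proof (rule dual_config)
    show "valid_table n (n + 1 - k) N.inv_entry (cval n A) (E + ell n A)"
      by (rule N.valid_inv_table[OF assms(2,3)])
    show "valid_table n (n + 1 - k) R.inv_entry (cval n (reflect n A)) (- E + ell n (reflect n A))"
      by (rule R.valid_inv_table) (use assms in \<open>simp_all add: ell cval\<close>)
    show "R.inv_entry i = int i - 1 - N.inv_entry i" if "i \<in> {1..n}" "i \<noteq> n + 1 - k - 1" for i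
      using other that by (simp only: K)
    show "R.inv_entry (n + 1 - k - 1) = int (n + 1 - k) - 2 - N.inv_entry (n + 1 - k) - cval n A"
      unfolding K closing N.inv_entry_opening using N.below_closing_total b N.neutral by simp
    show "cval n (reflect n A) = N.inv_entry (n + 1 - k) - 1 - N.inv_entry (n + 1 - k - 1)"
      unfolding K cval N.inv_entry_opening by simp
    show "- E + ell n (reflect n A) =
      N.inv_entry (n + 1 - k) + cval n A - N.inv_entry (n + 1 - k - 1) - (E + ell n A) - 1"
      unfolding K ell N.inv_entry_opening by simp
  qed
  then show ?thesis
    unfolding Phi_eq_config[OF N.gen_inv_table_eq] Phi_eq_config[OF R.gen_inv_table_eq] .
qed


section \<open>The discharging procedure\<close>

lemma bij_extend_identity:
  assumes "finite S" "inj_on f S" "\<And>x. x \<in> S \<Longrightarrow> f x \<in> S" "\<And>x. x \<notin> S \<Longrightarrow> f x = x"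
  shows "bij f"
proof (rule bijI)
  show "inj f"
  proof (rule injI)
    fix x y assume xy: "f x = f y"
    show "x = y"
    proof (cases "x \<in> S")
      case True
      then have "y \<in> S" using assms(3)[of x] assms(4)[of y] xy by metis
      then show ?thesis using True assms(2) xy by (auto dest: inj_onD)
    next
      case False
      then have "y \<notin> S" using assms(3)[of y] assms(4)[of x] xy by metis
      then show ?thesis using False assms(4) xy by metis
    qed
  qed
  have "f ` S = S" using assms(1,2,3) by (intro endo_inj_surj) auto
  then show "surj f" using assms(4) by (metis surjI surj_def image_iff)
qed

text \<open>One step backwards around the cycle \<open>S\<close>: the new column \<open>j\<close> is
  read from the old column \<open>cyc_pred S j\<close>. In the discharging procedure the last column
  of the extended closing cell is zero, so reading it at \<open>Min S\<close> has the same effect as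
  clearing the first column, and \<open>Hdisp\<close> becomes a bijection of columns.\<close>

definition cyc_pred :: "nat set \<Rightarrow> nat \<Rightarrow> nat" where
  "cyc_pred S j = (if j \<notin> S then j else if j = Min S then Max S else Max {j' \<in> S. j' < j})"

lemma cyc_pred_not_in: "j \<notin> S \<Longrightarrow> cyc_pred S j = j"
  by (simp add: cyc_pred_def)

lemma cyc_pred_less:
  assumes "finite S" "j \<in> S" "j \<noteq> Min S"
  shows "cyc_pred S j = Max {j' \<in> S. j' < j}" "cyc_pred S j \<in> S" "cyc_pred S j < j"
proof -
  show *: "cyc_pred S j = Max {j' \<in> S. j' < j}" using assms by (simp add: cyc_pred_def)
  have "S \<noteq> {}" using assms(2) by blast
  then have "Min S \<in> S" "Min S < j" using assms by (auto simp: less_le)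
  then have "Max {j' \<in> S. j' < j} \<in> {j' \<in> S. j' < j}" using assms(1) by (intro Max_in) auto
  then show "cyc_pred S j \<in> S" "cyc_pred S j < j" by (auto simp: *)
qed

lemma cyc_pred_in: "finite S \<Longrightarrow> j \<in> S \<Longrightarrow> cyc_pred S j \<in> S"
  using cyc_pred_less(2)[of S j] Max_in[of S] by (metis cyc_pred_def empty_iff)

lemma bij_cyc_pred:
  assumes "finite S"
  shows "bij (cyc_pred S)"
proof (rule bij_extend_identity[OF assms])
  have neq: "cyc_pred S x \<noteq> cyc_pred S y" if "x \<in> S" "y \<in> S" "x < y" for x y
  proof -
    have "Min S \<le> x" "y \<le> Max S" using that assms by auto
    then have y: "y \<noteq> Min S" using that by auto
    have le: "x \<le> cyc_pred S y"
      unfolding cyc_pred_less(1)[OF assms that(2) y] using assms that by (intro Max_ge) auto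
    show ?thesis
    proof (cases "x = Min S")
      case True
      then have "cyc_pred S x = Max S" using that by (simp add: cyc_pred_def)
      then show ?thesis using cyc_pred_less(3)[OF assms that(2) y] \<open>y \<le> Max S\<close> by simp
    next
      case False
      then show ?thesis using cyc_pred_less(3)[OF assms that(1) False] le by simp
    qed
  qed
  show "inj_on (cyc_pred S) S" using neq by (intro inj_onI) (metis linorder_neqE_nat)
qed (use assms in \<open>auto intro: cyc_pred_in cyc_pred_not_in\<close>)

definition perm_mat :: "nat \<Rightarrow> mat \<Rightarrow> bool" where
  "perm_mat n P \<longleftrightarrow> (\<forall>i j. P i j = 0 \<or> P i j = 1) \<and> (\<forall>i j. P i j \<noteq> 0 \<longrightarrow> i \<in> {1..n} \<and> j \<in> {1..n}) \<and>
     (\<forall>i\<in>{1..n}. \<exists>!j. P i j = 1) \<and> (\<forall>j\<in>{1..n}. \<exists>!i. P i j = 1)"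

lemma perm_matD:
  assumes "perm_mat n P"
  shows "P i j = 0 \<or> P i j = 1" "P i j \<noteq> 0 \<Longrightarrow> i \<in> {1..n} \<and> j \<in> {1..n}"
    "i \<in> {1..n} \<Longrightarrow> \<exists>!j. P i j = 1" "j \<in> {1..n} \<Longrightarrow> \<exists>!i. P i j = 1"
    "P i j = 1 \<Longrightarrow> P i j' = 1 \<Longrightarrow> j = j'" "P i j = 1 \<Longrightarrow> P i' j = 1 \<Longrightarrow> i = i'"
proof -
  show *: "P i j = 0 \<or> P i j = 1" "P i j \<noteq> 0 \<Longrightarrow> i \<in> {1..n} \<and> j \<in> {1..n}"
    "i \<in> {1..n} \<Longrightarrow> \<exists>!j. P i j = 1" "j \<in> {1..n} \<Longrightarrow> \<exists>!i. P i j = 1" for i j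
    using assms unfolding perm_mat_def by blast+
  show "P i j = 1 \<Longrightarrow> P i j' = 1 \<Longrightarrow> j = j'" using *(2)[of i j] *(3)[of i] by (metis zero_neq_one)
  show "P i j = 1 \<Longrightarrow> P i' j = 1 \<Longrightarrow> i = i'" using *(2)[of i j] *(4)[of j] by (metis zero_neq_one)
qed

lemma ex1_bij:
  assumes "bij f"
  shows "(\<exists>!x. Q (f x)) \<longleftrightarrow> (\<exists>!y. Q y)"
proof -
  have s: "f (inv f y) = y" for y using assms by (simp add: bij_is_surj surj_f_inv_f)
  have i: "inv f (f x) = x" for x using assms by (simp add: bij_is_inj)
  show ?thesis
  proof
    assume "\<exists>!x. Q (f x)"
    then obtain x where x: "Q (f x)" "\<And>x'. Q (f x') \<Longrightarrow> x' = x" by blast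
    show "\<exists>!y. Q y"
    proof (rule ex1I[of _ "f x"])
      fix y assume "Q y"
      then have "inv f y = x" using x(2)[of "inv f y"] s by simp
      then show "y = f x" using s by metis
    qed (rule x(1))
  next
    assume "\<exists>!y. Q y"
    then obtain y where y: "Q y" "\<And>y'. Q y' \<Longrightarrow> y' = y" by blast
    show "\<exists>!x. Q (f x)"
    proof (rule ex1I[of _ "inv f y"])
      fix x assume "Q (f x)"
      then have "f x = y" by (rule y(2))
      then show "x = inv f y" using i by metis
    qed (simp add: s y(1))
  qed
qed

lemma perm_mat_reindex_rows:
  assumes P: "perm_mat n P" and f: "bij f" "\<And>i. f i \<in> {1..n} \<longleftrightarrow> i \<in> {1..n}"
  shows "perm_mat n (\<lambda>i j. P (f i) j)"
  unfolding perm_mat_def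
proof (intro conjI allI ballI impI)
  show "P (f i) j = 0 \<or> P (f i) j = 1" for i j using perm_matD(1)[OF P] by blast
  show "i \<in> {1..n}" "j \<in> {1..n}" if "P (f i) j \<noteq> 0" for i j
    using perm_matD(2)[OF P that] f(2) by blast+
  show "\<exists>!j. P (f i) j = 1" if "i \<in> {1..n}" for i using perm_matD(3)[OF P] that f(2) by blast
  show "\<exists>!i. P (f i) j = 1" if "j \<in> {1..n}" for j
    by (rule iffD2[OF ex1_bij[OF f(1), of "\<lambda>i. P i j = 1"] perm_matD(4)[OF P that]])
qed

lemma cell_sum_eq_card:
  assumes "finite R" "finite C" "\<And>i j. i \<in> R \<Longrightarrow> j \<in> C \<Longrightarrow> A i j = 0 \<or> A i j = 1"
    and "\<And>i i' j. i \<in> R \<Longrightarrow> i' \<in> R \<Longrightarrow> j \<in> C \<Longrightarrow> A i j = 1 \<Longrightarrow> A i' j = 1 \<Longrightarrow> i = i'"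
  shows "cell_sum A R C = int (card {j \<in> C. \<exists>i\<in>R. A i j = 1})"
proof -
  have "(\<Sum>i\<in>R. A i j) = (if \<exists>i\<in>R. A i j = 1 then 1 else 0)" if j: "j \<in> C" for j
  proof (cases "\<exists>i\<in>R. A i j = 1")
    case True
    then obtain i where i: "i \<in> R" "A i j = 1" by blast
    have "(\<Sum>i'\<in>R. A i' j) = (\<Sum>i'\<in>R. if i' = i then 1 else 0)"
    proof (rule sum.cong[OF refl])
      fix i' assume i': "i' \<in> R"
      have "A i' j \<noteq> 1" if "i' \<noteq> i" using assms(4)[OF i' i(1) j _ i(2)] that by blast
      then show "A i' j = (if i' = i then 1 else 0)" using assms(3)[OF i' j] i(2) by auto
    qed
    then show ?thesis using True i assms(1) by simp
  next
    case False
    have "A i j = 0" if "i \<in> R" for i using assms(3)[OF that j] False that by blast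
    then show ?thesis using False by simp
  qed
  then have "cell_sum A R C = (\<Sum>j\<in>C. if \<exists>i\<in>R. A i j = 1 then 1 else 0)"
    unfolding cell_sum_eq by (rule sum.cong[OF refl])
  also have "\<dots> = int (card {j \<in> C. \<exists>i\<in>R. A i j = 1})"
    using assms(2) by (simp add: sum.If_cases Int_def)
  finally show ?thesis .
qed

text \<open>Used to find a closing column of prescribed rank among its candidates;
  \<open>rank_unique\<close> shows that the rank identifies it.\<close>

lemma exists_rank:
  fixes D :: "nat set"
  assumes "finite D" "t < card D"
  obtains x where "x \<in> D" "card {j \<in> D. j < x} = t"
  using assms
proof (induction "card D" arbitrary: D thesis)
  case (Suc d)
  then have ne: "D \<noteq> {}" by auto
  let ?M = "Max D"
  have M: "?M \<in> D" "\<And>j. j \<in> D \<Longrightarrow> j \<le> ?M" using ne Suc.prems by auto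
  show thesis
  proof (cases "t = d")
    case True
    have "{j \<in> D. j < ?M} = D - {?M}" using M by (auto simp: less_le)
    then have "card {j \<in> D. j < ?M} = t" using Suc M True by simp
    then show thesis using Suc.prems M by blast
  next
    case False
    have "d = card (D - {?M})" using Suc M by simp
    moreover have "t < card (D - {?M})" using Suc M False by simp
    ultimately obtain x where x: "x \<in> D - {?M}" "card {j \<in> D - {?M}. j < x} = t"
      using Suc.hyps(1)[of "D - {?M}"] Suc.prems by auto
    have "{j \<in> D - {?M}. j < x} = {j \<in> D. j < x}" using x M(2)[of x] by auto
    then show thesis using Suc.prems(1)[of x] x by auto
  qed
qed simp

lemma rank_unique:
  fixes D :: "nat set"
  assumes "finite D" "x \<in> D" "y \<in> D" "card {j \<in> D. j < x} = card {j \<in> D. j < y}"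
  shows "x = y"
proof (rule ccontr)
  assume "x \<noteq> y"
  have "card {j \<in> D. j < x'} < card {j \<in> D. j < y'}" if "x' \<in> D" "x' < y'" for x' y'
    using assms(1) that by (intro psubset_card_mono) auto
  from this[of x y] this[of y x] \<open>x \<noteq> y\<close> assms show False by linarith
qed

lemma Max_translate:
  assumes "finite X" "X \<noteq> {}"
  shows "Max ((\<lambda>y. m + y - 1) ` X) = m + Max X - (1::nat)"
  by (rule mono_Max_commute[symmetric]) (use assms in \<open>auto simp: mono_def\<close>)

lemma Min_translate:
  assumes "finite X" "X \<noteq> {}"
  shows "Min ((\<lambda>y. m + y - 1) ` X) = m + Min X - (1::nat)"
  by (rule mono_Min_commute[symmetric]) (use assms in \<open>auto simp: mono_def\<close>)

section \<open>The displacements in the coordinates of the whole matrix\<close>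

text \<open>Removes the block coordinates: a block column \<open>z\<close> is the matrix column
  \<open>m + z - 1\<close>, a translation that commutes with \<open>Max\<close>. The letters are
  those of \<open>asm_at\<close>, so \<open>m\<close> and \<open>c\<close> are columns here and not
  sizes of a block.\<close>

lemma replace_block_Hdisp:
  fixes B :: mat and r m c n :: nat
  assumes "1 \<le> m" "m \<le> c"
  defines "J \<equiv> {j \<in> {m..c}. \<exists>i\<in>{r<..n}. B i j \<noteq> 0}"
  shows "replace_block B (r + 1) m (n - r) (c - m + 1)
      (Hdisp (n - r) (c - m + 1) (submat B (r + 1) m (n - r) (c - m + 1))) i j =
    (if i \<in> {r<..n} \<and> j \<in> {m..c} then
       if j \<in> insert c J \<and> (\<exists>j'\<in>J. j' < j) then B i (Max {j' \<in> J. j' < j}) else 0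
     else B i j)"
proof (cases "i \<in> {r<..n} \<and> j \<in> {m..c}")
  case False
  then have "\<not> (i \<in> {r + 1..<r + 1 + (n - r)} \<and> j \<in> {m..<m + (c - m + 1)})" using assms(1,2) by auto
  then show ?thesis using False unfolding replace_block_def by (simp only: if_False)
next
  case True
  define q where "q = c - m + 1"
  define P where "P = submat B (r + 1) m (n - r) q"
  define J' where "J' = {y \<in> {1..q}. \<exists>x\<in>{1..n - r}. P x y \<noteq> 0}"
  define y where "y = j + 1 - m"
  have in': "i \<in> {r + 1..<r + 1 + (n - r)} \<and> j \<in> {m..<m + q}" using True assms(1,2) by (auto simp: q_def)
  have y: "y \<in> {1..q}" "m + y - 1 = j" using True assms(1,2) by (auto simp: y_def q_def)
  have P: "P x z = B (r + x) (m + z - 1)" if "x \<in> {1..n - r}" "z \<in> {1..q}" for x z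
    using that by (simp add: P_def submat_def)
  have J'_iff: "z \<in> J' \<longleftrightarrow> m + z - 1 \<in> J" if z: "z \<in> {1..q}" for z
  proof -
    have "(\<exists>x\<in>{1..n - r}. P x z \<noteq> 0) \<longleftrightarrow> (\<exists>x\<in>{1..n - r}. B (r + x) (m + z - 1) \<noteq> 0)"
      using P z by auto
    also have "\<dots> \<longleftrightarrow> (\<exists>i\<in>{r<..n}. B i (m + z - 1) \<noteq> 0)"
    proof
      assume "\<exists>x\<in>{1..n - r}. B (r + x) (m + z - 1) \<noteq> 0"
      then obtain x where x: "x \<in> {1..n - r}" "B (r + x) (m + z - 1) \<noteq> 0" by blast
      have "r + x \<in> {r<..n}" using x(1) by auto
      then show "\<exists>i\<in>{r<..n}. B i (m + z - 1) \<noteq> 0" using x(2) by blast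
    next
      assume "\<exists>i\<in>{r<..n}. B i (m + z - 1) \<noteq> 0"
      then obtain i' where i': "i' \<in> {r<..n}" "B i' (m + z - 1) \<noteq> 0" by blast
      have "i' - r \<in> {1..n - r}" "r + (i' - r) = i'" using i'(1) by auto
      then show "\<exists>x\<in>{1..n - r}. B (r + x) (m + z - 1) \<noteq> 0" using i'(2) by metis
    qed
    finally have "(\<exists>x\<in>{1..n - r}. P x z \<noteq> 0) \<longleftrightarrow> (\<exists>i\<in>{r<..n}. B i (m + z - 1) \<noteq> 0)" .
    moreover have "m + z - 1 \<in> {m..c}" using z assms(1,2) by (auto simp: q_def)
    ultimately show ?thesis using z unfolding J'_def J_def by blast
  qed
  have img: "{j' \<in> J. j' < j} = (\<lambda>z. m + z - 1) ` {z \<in> J'. z < y}"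
  proof (intro equalityI subsetI)
    fix j' assume j': "j' \<in> {j' \<in> J. j' < j}"
    then have "j' + 1 - m \<in> {1..q}" "m + (j' + 1 - m) - 1 = j'" "j' + 1 - m < y"
      using assms(1,2) True by (auto simp: J_def q_def y_def)
    then show "j' \<in> (\<lambda>z. m + z - 1) ` {z \<in> J'. z < y}"
      using J'_iff[of "j' + 1 - m"] j' by (intro image_eqI[of _ _ "j' + 1 - m"]) simp_all
  next
    fix j' assume "j' \<in> (\<lambda>z. m + z - 1) ` {z \<in> J'. z < y}"
    then obtain z where z: "z \<in> J'" "z < y" "j' = m + z - 1" by blast
    then have "z \<in> {1..q}" by (simp add: J'_def)
    then show "j' \<in> {j' \<in> J. j' < j}" using J'_iff[of z] z y by auto
  qed
  have ex: "(\<exists>z\<in>J'. z < y) \<longleftrightarrow> (\<exists>j'\<in>J. j' < j)" using img by blast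
  have ins: "y \<in> insert q J' \<longleftrightarrow> j \<in> insert c J"
    using J'_iff[OF y(1)] y True assms(1,2) by (auto simp: q_def y_def)
  have "replace_block B (r + 1) m (n - r) q (Hdisp (n - r) q P) i j = Hdisp (n - r) q P (i + 1 - (r + 1)) y"
    using in' unfolding replace_block_def y_def by (simp only: if_True simp_thms)
  also have "\<dots> = (if y \<in> insert q J' \<and> (\<exists>z\<in>J'. z < y) then P (i - r) (Max {z \<in> J'. z < y}) else 0)"
    using True unfolding Hdisp_def Let_def J'_def[symmetric] by auto
  also have "\<dots> = (if j \<in> insert c J \<and> (\<exists>j'\<in>J. j' < j) then B i (Max {j' \<in> J. j' < j}) else 0)"
  proof (cases "\<exists>j'\<in>J. j' < j")
    case ne: True
    then have X: "finite {z \<in> J'. z < y}" "{z \<in> J'. z < y} \<noteq> {}" using ex by (auto simp: J'_def)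
    have "Max {z \<in> J'. z < y} \<in> {z \<in> J'. z < y}" using Max_in[OF X] .
    then have "P (i - r) (Max {z \<in> J'. z < y}) = B (r + (i - r)) (m + Max {z \<in> J'. z < y} - 1)"
      using True by (intro P) (auto simp: J'_def)
    also have "\<dots> = B i (Max {j' \<in> J. j' < j})" unfolding img Max_translate[OF X] using True by simp
    finally show ?thesis unfolding ex ins by simp
  next
    case False
    then show ?thesis unfolding ex by auto
  qed
  finally show ?thesis using True unfolding q_def P_def by (simp only: if_True simp_thms)
qed

lemma replace_block_Vdisp:
  fixes B :: mat and k r m :: nat
  assumes "1 \<le> k" "k \<le> r" "1 \<le> m"
  defines "I \<equiv> {i \<in> {k..r}. \<exists>j\<in>{1..<m}. B i j \<noteq> 0}"
  shows "replace_block B k 1 (r - k + 1) (m - 1)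
      (Vdisp (r - k + 1) (m - 1) (submat B k 1 (r - k + 1) (m - 1))) i j =
    (if i \<in> {k..r} \<and> j \<in> {1..<m} then
       if i \<in> insert k I \<and> (\<exists>i'\<in>I. i < i') then B (Min {i' \<in> I. i < i'}) j else 0
     else B i j)"
proof (cases "i \<in> {k..r} \<and> j \<in> {1..<m}")
  case False
  then have "\<not> (i \<in> {k..<k + (r - k + 1)} \<and> j \<in> {1..<1 + (m - 1)})" using assms(1-3) by auto
  then show ?thesis using False unfolding replace_block_def by (simp only: if_False)
next
  case True
  define q where "q = r - k + 1"
  define P where "P = submat B k 1 q (m - 1)"
  define I' where "I' = {x \<in> {1..q}. \<exists>y\<in>{1..m - 1}. P x y \<noteq> 0}"
  define x where "x = i + 1 - k"
  have in': "i \<in> {k..<k + q} \<and> j \<in> {1..<1 + (m - 1)}" using True assms(1,2) by (auto simp: q_def)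
  have x: "x \<in> {1..q}" "k + x - 1 = i" using True assms(1,2) by (auto simp: x_def q_def)
  have P: "P z y = B (k + z - 1) y" if "z \<in> {1..q}" "y \<in> {1..m - 1}" for z y
    using that by (simp add: P_def submat_def)
  have ms: "{1..m - 1} = {1..<m}" using assms(3) by auto
  have I'_iff: "z \<in> I' \<longleftrightarrow> k + z - 1 \<in> I" if z: "z \<in> {1..q}" for z
  proof -
    have "(\<exists>y\<in>{1..m - 1}. P z y \<noteq> 0) \<longleftrightarrow> (\<exists>y\<in>{1..<m}. B (k + z - 1) y \<noteq> 0)"
      using P[OF z] unfolding ms by auto
    moreover have "k + z - 1 \<in> {k..r}" using z assms(1,2) by (auto simp: q_def)
    ultimately show ?thesis using z unfolding I'_def I_def by blast
  qed
  have img: "{i' \<in> I. i < i'} = (\<lambda>z. k + z - 1) ` {z \<in> I'. x < z}"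
  proof (intro equalityI subsetI)
    fix i' assume i': "i' \<in> {i' \<in> I. i < i'}"
    then have "i' + 1 - k \<in> {1..q}" "k + (i' + 1 - k) - 1 = i'" "x < i' + 1 - k"
      using assms(1-3) True by (auto simp: I_def q_def x_def)
    then show "i' \<in> (\<lambda>z. k + z - 1) ` {z \<in> I'. x < z}"
      using I'_iff[of "i' + 1 - k"] i' by (intro image_eqI[of _ _ "i' + 1 - k"]) simp_all
  next
    fix i' assume "i' \<in> (\<lambda>z. k + z - 1) ` {z \<in> I'. x < z}"
    then obtain z where z: "z \<in> I'" "x < z" "i' = k + z - 1" by blast
    then have "z \<in> {1..q}" by (simp add: I'_def)
    then show "i' \<in> {i' \<in> I. i < i'}" using I'_iff[of z] z x by auto
  qed
  have ex: "(\<exists>z\<in>I'. x < z) \<longleftrightarrow> (\<exists>i'\<in>I. i < i')" using img by blast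
  have ins: "x \<in> insert 1 I' \<longleftrightarrow> i \<in> insert k I"
    using I'_iff[OF x(1)] x True assms(1-3) by (auto simp: q_def x_def)
  have "replace_block B k 1 q (m - 1) (Vdisp q (m - 1) P) i j = Vdisp q (m - 1) P x (j + 1 - 1)"
    using in' unfolding replace_block_def x_def by (simp only: if_True simp_thms)
  also have "\<dots> = (if x \<in> insert 1 I' \<and> (\<exists>z\<in>I'. x < z) then P (Min {z \<in> I'. x < z}) j else 0)"
    using True unfolding Vdisp_def Let_def I'_def[symmetric] by auto
  also have "\<dots> = (if i \<in> insert k I \<and> (\<exists>i'\<in>I. i < i') then B (Min {i' \<in> I. i < i'}) j else 0)"
  proof (cases "\<exists>i'\<in>I. i < i'")
    case ne: True
    then have X: "finite {z \<in> I'. x < z}" "{z \<in> I'. x < z} \<noteq> {}" using ex by (auto simp: I'_def)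
    have "Min {z \<in> I'. x < z} \<in> {z \<in> I'. x < z}" using Min_in[OF X] .
    then have "P (Min {z \<in> I'. x < z}) j = B (k + Min {z \<in> I'. x < z} - 1) j"
      using True by (intro P) (auto simp: I'_def)
    also have "\<dots> = B (Min {i' \<in> I. i < i'}) j" unfolding img Min_translate[OF X] ..
    finally show ?thesis unfolding ex ins by simp
  next
    case False
    then show ?thesis unfolding ex by auto
  qed
  finally show ?thesis using True unfolding q_def P_def by (simp only: if_True simp_thms)
qed

context asm_at
begin

section \<open>Steps (1) and (2): a cycle of columns below the closing row\<close>

text \<open>The column \<open>c\<close> is inserted by hand: it is zero below the closing row, but
  it receives a column under \<open>Hdisp\<close>.\<close>

definition shift_cols :: "nat set" where
  "shift_cols = insert c {j \<in> {m..c}. \<exists>i\<in>{r<..n}. A i j = 1}"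

text \<open>The matrix after the steps (1) and (2) of the discharging procedure, as
  \<open>step_two\<close> shows.\<close>

definition shifted :: mat where
  "shifted i j = (if r < i then A i (cyc_pred shift_cols j)
     else if (i, j) = (r, m) \<or> (i, j) = (r, c) then 0 else A i j)"

lemma shift_cols_bounds: "j \<in> shift_cols \<Longrightarrow> m \<le> j \<and> j \<le> c"
  using bounds by (auto simp: shift_cols_def)

lemma finite_shift_cols: "finite shift_cols"
  by (simp add: shift_cols_def)

lemma m_c_in_shift_cols: "m \<in> shift_cols" "c \<in> shift_cols"
  using bounds ones by (auto simp: shift_cols_def intro!: bexI[of _ u])

lemma Min_shift_cols: "Min shift_cols = m" and Max_shift_cols: "Max shift_cols = c"
  using finite_shift_cols m_c_in_shift_cols shift_cols_bounds by (auto intro!: Min_eqI Max_eqI)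

lemma below_closing_iff:
  assumes "j \<noteq> c"
  shows "j \<in> shift_cols \<longleftrightarrow> j \<in> {m..c} \<and> (\<exists>i. r < i \<and> A i j = 1)"
proof -
  have "i \<le> n" if "A i j = 1" for i using support[of i j] that by simp
  then show ?thesis using assms by (auto simp: shift_cols_def)
qed

lemma closing_col_empty: "r < i \<Longrightarrow> A i c = 0"
  using nonneg[of i c] col_unique[of c i r] ones bounds by auto

lemmas bij_shift = bij_cyc_pred[OF finite_shift_cols]

lemma shift_m: "cyc_pred shift_cols m = c"
  using m_c_in_shift_cols by (simp add: cyc_pred_def Min_shift_cols Max_shift_cols)

lemma shift_in:
  assumes "j \<in> shift_cols" "j \<noteq> m"
  shows "cyc_pred shift_cols j \<in> shift_cols" "cyc_pred shift_cols j \<noteq> c" "\<exists>i>r. A i (cyc_pred shift_cols j) = 1"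
proof -
  note p = cyc_pred_less[OF finite_shift_cols assms(1), unfolded Min_shift_cols, OF assms(2)]
  show 1: "cyc_pred shift_cols j \<in> shift_cols" by (rule p(2))
  show 2: "cyc_pred shift_cols j \<noteq> c" using p(3) shift_cols_bounds[OF assms(1)] by auto
  show "\<exists>i>r. A i (cyc_pred shift_cols j) = 1" using below_closing_iff[OF 2] 1 by blast
qed

lemma shifted_eq_one:
  "shifted i j = 1 \<longleftrightarrow> r < i \<and> A i (cyc_pred shift_cols j) = 1 \<or> i = r \<and> j = l \<or> i < r \<and> A i j = 1"
  using bounds closing_row_ones[of j] by (auto simp: shifted_def)

text \<open>Column \<open>m\<close> receives the empty lower part of column \<open>c\<close> and
  keeps its upper 1. Any other column of the cycle has its 1 of \<open>A\<close> in the closing row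
  or below, where it is erased or moved on, and gets exactly one 1 from its predecessor. The closing
  row keeps only its left 1.\<close>

lemma shifted_perm: "perm_mat n shifted"
  unfolding perm_mat_def
proof (intro conjI allI ballI impI)
  show "shifted i j = 0 \<or> shifted i j = 1" for i j
    using nonneg[of i "cyc_pred shift_cols j"] nonneg[of i j] by (auto simp: shifted_def)
  show "i \<in> {1..n}" if "shifted i j \<noteq> 0" for i j
    using that support[of i j] support[of i "cyc_pred shift_cols j"] by (auto simp: shifted_def split: if_splits)
  show "j \<in> {1..n}" if "shifted i j \<noteq> 0" for i j
  proof (cases "j \<in> shift_cols")
    case True
    then show ?thesis using shift_cols_bounds[OF True] bounds by auto
  next
    case False
    then show ?thesis
      using that support[of i j] by (auto simp: shifted_def cyc_pred_not_in split: if_splits)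
  qed
  show "\<exists>!j. shifted i j = 1" if i: "i \<in> {1..n}" for i
  proof -
    consider "r < i" | "i = r" | "i < r" by linarith
    then show ?thesis
    proof cases
      case 1
      then have "\<exists>!j. A i (cyc_pred shift_cols j) = 1"
        using iffD2[OF ex1_bij[OF bij_shift, of "\<lambda>j. A i j = 1"] row_one[OF i]] by simp
      then show ?thesis using 1 by (simp add: shifted_eq_one)
    next
      case 2
      then show ?thesis by (simp add: shifted_eq_one)
    next
      case 3
      then show ?thesis using row_one[OF i] by (simp add: shifted_eq_one)
    qed
  qed
  show "\<exists>!i. shifted i j = 1" if j: "j \<in> {1..n}" for j
  proof -
    consider "j \<notin> shift_cols" | "j = m" | "j \<in> shift_cols" "j \<noteq> m" by blast
    then show ?thesis
    proof cases
      case 1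
      then have jm: "j \<noteq> m" "j \<noteq> c" using m_c_in_shift_cols by auto
      then have "shifted i j = 1 \<longleftrightarrow> A i j = 1" for i
        using closing_row_ones[of j] unfolding shifted_eq_one cyc_pred_not_in[OF 1]
        by (metis linorder_less_linear)
      then show ?thesis using col_one[OF j jm(1)] by simp
    next
      case 2
      have "shifted i m = 1 \<longleftrightarrow> i = k" for i
        using closing_col_empty[of i] opening_col_ones[of i] bounds
        unfolding shifted_eq_one shift_m by auto
      then show ?thesis by (simp add: 2)
    next
      case 3
      note s = shift_in[OF 3]
      obtain i where i: "r < i" "A i (cyc_pred shift_cols j) = 1" using s(3) by blast
      show ?thesis
      proof (rule ex1I[of _ i])
        show "shifted i j = 1" using i by (simp add: shifted_eq_one)
        fix i' assume "shifted i' j = 1"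
        then consider (below) "r < i'" "A i' (cyc_pred shift_cols j) = 1" | (closing) "j = l" | (above) "i' < r" "A i' j = 1"
          unfolding shifted_eq_one by blast
        then show "i' = i"
        proof cases
          case below
          show ?thesis
          proof (cases "cyc_pred shift_cols j = m")
            case True
            then show ?thesis using below i opening_col_ones bounds by auto
          next
            case False
            then show ?thesis using below i col_unique by blast
          qed
        next
          case closing
          then show ?thesis using shift_cols_bounds[OF 3(1)] bounds by auto
        next
          case above
          have "\<exists>i''\<ge>r. A i'' j = 1"
            using below_closing_iff[of j] 3(1) ones(2) by (cases "j = c") (auto intro: less_imp_le)
          then show ?thesis using col_unique[OF 3(2) above(2)] above(1) by (metis leD)
        qed
      qed
    qed
  qed
qed

section \<open>Steps (3) and (4): a permutation of rows\<close>

definition left_rows :: "nat set" where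
  "left_rows = {i \<in> {k..r}. \<exists>j\<in>{1..<m}. A i j = 1}"

text \<open>Since every row strictly between the opening row and the closing row lies entirely in the left or
  entirely in the right side, steps (3) and (4) together amount to a permutation of whole rows.\<close>

definition lowered_row :: "nat \<Rightarrow> nat" where
  "lowered_row i = (if i \<in> {k<..r} then
     if i - 1 \<in> insert k left_rows then Min {i' \<in> left_rows. i \<le> i'} else i - 1 else i)"

lemma r_in_left_rows: "r \<in> left_rows"
  using bounds ones by (auto simp: left_rows_def intro!: bexI[of _ l])

lemma k_notin_left_rows: "k \<notin> left_rows"
proof
  assume "k \<in> left_rows"
  then obtain j where "j < m" "A k j = 1" by (auto simp: left_rows_def)
  then show False using row_unique[of k j m] ones bounds by simp
qed

lemma left_rows_bounds: "i \<in> left_rows \<Longrightarrow> k < i \<and> i \<le> r"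
  using k_notin_left_rows by (cases "i = k") (auto simp: left_rows_def)

lemma Min_left_rows:
  assumes "i \<le> r"
  shows "Min {i' \<in> left_rows. i \<le> i'} \<in> left_rows" "i \<le> Min {i' \<in> left_rows. i \<le> i'}"
    "i' \<in> left_rows \<Longrightarrow> i \<le> i' \<Longrightarrow> Min {i' \<in> left_rows. i \<le> i'} \<le> i'"
proof -
  have f: "finite {i' \<in> left_rows. i \<le> i'}" by (simp add: left_rows_def)
  have "Min {i' \<in> left_rows. i \<le> i'} \<in> {i' \<in> left_rows. i \<le> i'}"
    using r_in_left_rows assms by (intro Min_in[OF f]) auto
  then show "Min {i' \<in> left_rows. i \<le> i'} \<in> left_rows" "i \<le> Min {i' \<in> left_rows. i \<le> i'}" by auto
  show "i' \<in> left_rows \<Longrightarrow> i \<le> i' \<Longrightarrow> Min {i' \<in> left_rows. i \<le> i'} \<le> i'" using f by (intro Min_le) auto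
qed

text \<open>\<open>Vdisp\<close> puts into row \<open>i - 1\<close> the next left row strictly after
  it, that is, the first one from row \<open>i\<close> on, and lowering carries it to row
  \<open>i\<close>. Rows of the charged cell are only lowered, as in
  \<open>lowered_row_right\<close>.\<close>

lemma lowered_row_left:
  assumes "i \<in> {k<..r}" "i - 1 \<in> insert k left_rows"
  shows "lowered_row i = Min {i' \<in> left_rows. i \<le> i'}" "lowered_row i \<in> left_rows" "i \<le> lowered_row i"
  using assms Min_left_rows[of i] by (auto simp: lowered_row_def)

lemma lowered_row_right:
  assumes "i \<in> {k<..r}" "i - 1 \<notin> insert k left_rows"
  shows "lowered_row i = i - 1" "lowered_row i \<in> {k<..<r}" "lowered_row i \<notin> left_rows"
  using assms by (auto simp: lowered_row_def)

lemma lowered_row_in: "i \<in> {k<..r} \<Longrightarrow> lowered_row i \<in> {k<..r}"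
  using lowered_row_left(2)[of i] lowered_row_right(2)[of i] left_rows_bounds[of "lowered_row i"]
  by (cases "i - 1 \<in> insert k left_rows") auto

lemma lowered_row_out: "i \<notin> {k<..r} \<Longrightarrow> lowered_row i = i"
  by (auto simp: lowered_row_def)

text \<open>The two clauses have images inside and outside \<open>left_rows\<close>. If both
  \<open>x < y\<close> use the first clause, then \<open>y - 1\<close> is itself a left row not
  above \<open>x\<close>, so the image of \<open>x\<close> is at most \<open>y - 1\<close>, while
  the image of \<open>y\<close> is at least \<open>y\<close>.\<close>

lemma bij_lowered_row: "bij lowered_row"
proof (rule bij_extend_identity[of "{k<..r}"])
  have neq: "lowered_row x \<noteq> lowered_row y" if xy: "x \<in> {k<..r}" "y \<in> {k<..r}" "x < y" for x y
  proof -
    let ?L = "\<lambda>i. i - 1 \<in> insert k left_rows"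
    consider "?L x" "?L y" | "?L x" "\<not> ?L y" | "\<not> ?L x" "?L y" | "\<not> ?L x" "\<not> ?L y" by blast
    then show ?thesis
    proof cases
      case 1
      then have "y - 1 \<in> left_rows" "x \<le> y - 1" using xy by auto
      then have "lowered_row x \<le> y - 1"
        unfolding lowered_row_left(1)[OF xy(1) 1(1)] using xy by (intro Min_left_rows(3)) auto
      then show ?thesis using lowered_row_left(3)[OF xy(2) 1(2)] xy by auto
    next
      case 2
      then show ?thesis using lowered_row_left(2)[OF xy(1) 2(1)] lowered_row_right(3)[OF xy(2) 2(2)] by metis
    next
      case 3
      then show ?thesis using lowered_row_left(2)[OF xy(2) 3(2)] lowered_row_right(3)[OF xy(1) 3(1)] by metis
    next
      case 4
      then show ?thesis using lowered_row_right(1)[OF xy(1) 4(1)] lowered_row_right(1)[OF xy(2) 4(2)] xy by auto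
    qed
  qed
  then show "inj_on lowered_row {k<..r}" by (intro inj_onI) (metis linorder_neqE_nat)
qed (use lowered_row_in lowered_row_out in auto)

text \<open>This includes the closing row, whose -1 and closing 1 were erased in step (1); it is
  what allows the left parts to be moved as whole rows.\<close>

lemma left_row_right_zero:
  assumes "i \<in> left_rows" "m \<le> j"
  shows "shifted i j = 0"
proof -
  obtain j' where "j' < m" "A i j' = 1" using assms(1) by (auto simp: left_rows_def)
  moreover have "i \<le> r" using left_rows_bounds[OF assms(1)] by simp
  ultimately have "shifted i j' = 1" using closing_row_ones[of j'] bounds by (auto simp: shifted_eq_one)
  then have "shifted i j \<noteq> 1" using perm_matD(5)[OF shifted_perm] \<open>j' < m\<close> assms(2) by fastforce
  then show ?thesis using perm_matD(1)[OF shifted_perm] by blast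
qed

lemma shifted_left: "i \<le> r \<Longrightarrow> j < m \<Longrightarrow> shifted i j = A i j"
  using bounds by (auto simp: shifted_def)

lemma opening_row_left_zero: "j \<noteq> m \<Longrightarrow> A k j = 0"
  using nonneg[of k j] row_unique[of k j m] ones bounds by auto

text \<open>Below the closing row, columns of the cell outside the cycle are zero and stay so,
  column \<open>m\<close> takes the zero column \<open>c\<close>, and the others take their
  predecessor, which is the \<open>Max\<close> in \<open>Hdisp\<close>.\<close>

lemma step_two:
  fixes B :: mat
  defines "B \<equiv> \<lambda>i j. if (i, j) = (r, m) \<or> (i, j) = (r, c) then 0 else A i j"
  shows "replace_block B (r + 1) m (n - r) (c - m + 1)
      (Hdisp (n - r) (c - m + 1) (submat B (r + 1) m (n - r) (c - m + 1))) = shifted"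
proof (intro ext)
  fix i j
  let ?J = "{j \<in> {m..c}. \<exists>i\<in>{r<..n}. B i j \<noteq> 0}"
  have B: "B i j = A i j" if "r < i" for i j using that by (auto simp: B_def)
  have nz: "A i j \<noteq> 0 \<longleftrightarrow> A i j = 1" if "r < i" for i j using nonneg[of i j] that by auto
  have J: "?J = shift_cols - {c}"
  proof -
    have "?J = {j \<in> {m..c}. \<exists>i\<in>{r<..n}. A i j = 1}" using B nz by auto
    moreover have "c \<notin> {j \<in> {m..c}. \<exists>i\<in>{r<..n}. A i j = 1}" using closing_col_empty by auto
    ultimately show ?thesis unfolding shift_cols_def by blast
  qed
  have "(if i \<in> {r<..n} \<and> j \<in> {m..c} then
       if j \<in> insert c ?J \<and> (\<exists>j'\<in>?J. j' < j) then B i (Max {j' \<in> ?J. j' < j}) else 0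
     else B i j) = shifted i j"
  proof (cases "i \<in> {r<..n} \<and> j \<in> {m..c}")
    case True
    then have i: "r < i" by simp
    have ins: "insert c ?J = shift_cols" unfolding J using m_c_in_shift_cols by blast
    have X: "{j' \<in> ?J. j' < j} = {j' \<in> shift_cols. j' < j}" unfolding J using True by auto
    consider "j \<notin> shift_cols" | "j = m" | "j \<in> shift_cols" "j \<noteq> m" by blast
    then have "(if j \<in> insert c ?J \<and> (\<exists>j'\<in>?J. j' < j) then B i (Max {j' \<in> ?J. j' < j}) else 0) = shifted i j"
    proof cases
      case 1
      then have "j \<noteq> c" using m_c_in_shift_cols by auto
      then have "A i j \<noteq> 1" using below_closing_iff[of j] 1 True i by blast
      then have "shifted i j = 0" using i nz[OF i] by (auto simp: shifted_def cyc_pred_not_in[OF 1])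
      then show ?thesis unfolding ins using 1 by simp
    next
      case 2
      have "\<not> (\<exists>j'\<in>?J. j' < j)" using 2 by auto
      moreover have "shifted i j = 0" using i closing_col_empty by (simp add: shifted_def 2 shift_m)
      ultimately show ?thesis by (simp only: if_False simp_thms)
    next
      case 3
      have "m \<in> ?J" unfolding J using m_c_in_shift_cols bounds by auto
      moreover have "m < j" using shift_cols_bounds[OF 3(1)] 3(2) by simp
      ultimately have "\<exists>j'\<in>?J. j' < j" by blast
      moreover have "B i (Max {j' \<in> ?J. j' < j}) = shifted i j"
        unfolding X using i cyc_pred_less(1)[OF finite_shift_cols 3(1), unfolded Min_shift_cols, OF 3(2)]
        by (simp add: shifted_def B)
      ultimately show ?thesis unfolding ins using 3(1) by (simp only: if_True simp_thms)
    qed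
    then show ?thesis using True by (simp only: if_True simp_thms)
  next
    case False
    have "B i j = shifted i j"
    proof (cases "r < i")
      case True
      show ?thesis
      proof (cases "j \<in> {m..c}")
        case True': True
        then have "\<not> i \<le> n" using False True by auto
        then have "A i j' = 0" for j' using support[of i j'] by auto
        then show ?thesis using True by (simp add: B shifted_def)
      next
        case False
        then have "j \<notin> shift_cols" using shift_cols_bounds by auto
        then show ?thesis using True by (simp add: B shifted_def cyc_pred_not_in)
      qed
    next
      case False
      then show ?thesis by (simp add: B_def shifted_def)
    qed
    then show ?thesis using False by (simp only: if_False)
  qed
  then show "replace_block B (r + 1) m (n - r) (c - m + 1)
      (Hdisp (n - r) (c - m + 1) (submat B (r + 1) m (n - r) (c - m + 1))) i j = shifted i j"
    using replace_block_Hdisp[of m c B r n i j] bounds by simp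
qed

text \<open>For a row \<open>i\<close> strictly below \<open>k\<close> and not below
  \<open>r\<close>, the two sides are treated separately by steps (3) and (4), yet both can be read
  from row \<open>lowered_row i\<close>: if this is a left row its right part is zero, and otherwise
  its left part is zero.\<close>

lemma delta_eq: "delta n A = (\<lambda>i j. shifted (lowered_row i) j)"
proof (intro ext)
  fix i j
  let ?B3 = "replace_block shifted k 1 (r - k + 1) (m - 1)
     (Vdisp (r - k + 1) (m - 1) (submat shifted k 1 (r - k + 1) (m - 1)))"
  have d: "delta n A i j = (if 1 \<le> j \<and> j < m \<and> k \<le> i \<and> i \<le> r then
        (if i = k then 0 else ?B3 (i - 1) j)
      else if m < j \<and> j \<le> n \<and> k < i \<and> i \<le> r then
        (if i = Suc k then 0 else ?B3 (i - 1) j)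
      else ?B3 i j)"
    unfolding delta_def Let_def frame_eqs step_two ..
  have I: "{i \<in> {k..r}. \<exists>j\<in>{1..<m}. shifted i j \<noteq> 0} = left_rows"
  proof -
    have "shifted i j \<noteq> 0 \<longleftrightarrow> A i j = 1" if "i \<le> r" "j < m" for i j
      using shifted_left[OF that] nonneg[of i j] that by auto
    then have "(\<exists>j\<in>{1..<m}. shifted i j \<noteq> 0) \<longleftrightarrow> (\<exists>j\<in>{1..<m}. A i j = 1)" if "i \<le> r" for i
      using that by (intro bex_cong) auto
    then show ?thesis unfolding left_rows_def by auto
  qed
  have B3: "?B3 i j = (if i \<in> {k..r} \<and> j \<in> {1..<m} then
       if i \<in> insert k left_rows \<and> (\<exists>i'\<in>left_rows. i < i') then shifted (Min {i' \<in> left_rows. i < i'}) j else 0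
     else shifted i j)" for i j
    using replace_block_Vdisp[of k r m shifted i j] bounds unfolding I by simp
  have sz: "shifted i 0 = 0" for i using perm_matD(2)[OF shifted_perm, of i 0] by auto
  have sn: "shifted i j = 0" if "n < j" for i j using perm_matD(2)[OF shifted_perm, of i j] that by auto
  consider (out) "i \<notin> {k..r}" | (top) "i = k" | (mid) "i \<in> {k<..r}" by fastforce
  then show "delta n A i j = shifted (lowered_row i) j"
  proof cases
    case out
    then have "lowered_row i = i" by (intro lowered_row_out) auto
    moreover have "?B3 i j = shifted i j" using out unfolding B3 by (simp only: if_False simp_thms)
    ultimately show ?thesis using out unfolding d by auto
  next
    case top
    have lk: "lowered_row k = k" by (simp add: lowered_row_out)
    have "shifted k j = 0" if "j < m" using opening_row_left_zero[of j] bounds that by (simp add: shifted_left)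
    then show ?thesis using bounds unfolding d B3 unfolding top lk by auto
  next
    case mid
    then have im: "i - 1 \<in> {k..r}" "Suc (i - 1) = i" "i \<noteq> k" "k < i" "i \<le> r" by auto
    have X: "{i' \<in> left_rows. i - 1 < i'} = {i' \<in> left_rows. i \<le> i'}" using im by auto
    have ex: "\<exists>i'\<in>left_rows. i - 1 < i'" using r_in_left_rows im by (intro bexI[of _ r]) auto
    consider (zero) "j = 0 \<or> n < j" | (left) "1 \<le> j" "j < m" | (m) "j = m" | (right) "m < j" "j \<le> n" by linarith
    then show ?thesis
    proof cases
      case zero
      then have "\<not> (1 \<le> j \<and> j < m)" "\<not> j \<le> n \<or> j = 0" using bounds by auto
      then have "delta n A i j = shifted i j" unfolding d B3 using bounds by auto
      then show ?thesis using zero sz sn by auto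
    next
      case left
      have "delta n A i j = ?B3 (i - 1) j" using left im unfolding d by simp
      also have "\<dots> = (if i - 1 \<in> insert k left_rows then shifted (Min {i' \<in> left_rows. i \<le> i'}) j else 0)"
        using left im(1) ex unfolding B3 X by simp
      also have "\<dots> = shifted (lowered_row i) j"
      proof (cases "i - 1 \<in> insert k left_rows")
        case True
        then show ?thesis using lowered_row_left(1)[OF mid True] by simp
      next
        case False
        have "A (i - 1) j \<noteq> 1" using False left im(1) by (auto simp: left_rows_def)
        moreover have "A (i - 1) j = 0 \<or> A (i - 1) j = 1" using left by (intro nonneg) auto
        ultimately have "shifted (i - 1) j = 0" using shifted_left[of "i - 1" j] left im by auto
        then show ?thesis using lowered_row_right(1)[OF mid False] False by simp
      qed
      finally show ?thesis .
    next
      case m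
      \<comment> \<open>The -1 is already erased and the lower 1 lies below the closing row, so the
        opening column vanishes on the permuted rows.\<close>
      have "shifted i' m = 0" if "i' \<in> {k<..r}" for i'
        using that opening_col_ones[of i'] nonneg[of i' m] bounds by (auto simp: shifted_def)
      moreover have "delta n A i j = shifted i m" unfolding d B3 unfolding m by simp
      ultimately show ?thesis using mid lowered_row_in[OF mid] m by simp
    next
      case right
      have "delta n A i j = (if i = Suc k then 0 else shifted (i - 1) j)"
        using right im unfolding d B3 by auto
      also have "\<dots> = shifted (lowered_row i) j"
      proof (cases "i - 1 \<in> insert k left_rows")
        case True
        \<comment> \<open>Both sides are zero: \<open>lowered_row i\<close> is a left row, and row
          \<open>i - 1\<close> is either a left row or the opening row, in which case step (4)
          writes zeros.\<close>
        have "shifted (lowered_row i) j = 0"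
          using left_row_right_zero[OF lowered_row_left(2)[OF mid True]] right by simp
        moreover have "i \<noteq> Suc k \<Longrightarrow> shifted (i - 1) j = 0"
          using True im right by (intro left_row_right_zero) auto
        ultimately show ?thesis by simp
      next
        case False
        then show ?thesis using lowered_row_right(1)[OF mid False] by auto
      qed
      finally show ?thesis .
    qed
  qed
qed

lemma lowered_row_range: "lowered_row i \<in> {1..n} \<longleftrightarrow> i \<in> {1..n}"
  using lowered_row_in[of i] lowered_row_out[of i] bounds by (cases "i \<in> {k<..r}") auto

lemma delta_perm: "perm_mat n (delta n A)"
  unfolding delta_eq by (rule perm_mat_reindex_rows[OF shifted_perm bij_lowered_row lowered_row_range])

lemma cval_eq_card: "cval n A = int (card (shift_cols - {m, c}))"
proof -
  have "cval n A = int (card {j \<in> {m<..<c}. \<exists>i\<in>{r<..n}. A i j = 1})"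
    unfolding cval_def frame_eqs
  proof (rule cell_sum_eq_card)
    show "A i j = 0 \<or> A i j = 1" if "i \<in> {r<..n}" for i j using that by (intro nonneg) auto
    show "i = i'" if "j \<in> {m<..<c}" "A i j = 1" "A i' j = 1" for i i' j using that col_unique[of j i i'] by auto
  qed auto
  also have "{j \<in> {m<..<c}. \<exists>i\<in>{r<..n}. A i j = 1} = shift_cols - {m, c}"
    by (auto simp: shift_cols_def)
  finally show ?thesis .
qed

end


section \<open>The neutralizing procedure\<close>

text \<open>The possible closing columns of a neutral matrix with discharge \<open>P\<close>,
  closing row \<open>r\<close> and opening column \<open>m\<close>.\<close>

definition right_cols_below :: "mat \<Rightarrow> nat \<Rightarrow> nat \<Rightarrow> nat set" where
  "right_cols_below P r m = {j. m < j \<and> (\<exists>i>r. P i j = 1)}"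

lemma finite_right_cols_below:
  assumes "perm_mat n P"
  shows "finite (right_cols_below P r m)"
proof (rule finite_subset)
  show "right_cols_below P r m \<subseteq> {1..n}"
  proof
    fix j assume "j \<in> right_cols_below P r m"
    then obtain i where "P i j = 1" by (auto simp: right_cols_below_def)
    then show "j \<in> {1..n}" using perm_matD(2)[OF assms, of i j] by simp
  qed
qed simp

context asm_at
begin

lemma delta_below: "r < i \<Longrightarrow> delta n A i j = A i (cyc_pred shift_cols j)"
  by (simp add: delta_eq lowered_row_out shifted_def)

lemma delta_opening: "delta n A k m = 1"
  using bounds ones by (simp add: delta_eq lowered_row_out shifted_eq_one)

text \<open>The clause \<open>i - 1 = k\<close> of \<open>lowered_row\<close> sends the highest left
  row, that of the leading 1, to row \<open>Suc k\<close>.\<close>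

lemma delta_leading: "\<exists>j<m. delta n A (Suc k) j = 1"
proof -
  have i: "Suc k \<in> {k<..r}" "Suc k - 1 \<in> insert k left_rows" using bounds by auto
  note L = lowered_row_left(2)[OF i]
  obtain j where "j < m" "A (lowered_row (Suc k)) j = 1" using L by (auto simp: left_rows_def)
  then show ?thesis using shifted_left[of "lowered_row (Suc k)" j] left_rows_bounds[OF L] by (auto simp: delta_eq)
qed

lemma shift_cols_subset: "shift_cols - {m} \<subseteq> right_cols_below (delta n A) r m"
proof
  fix j assume j: "j \<in> shift_cols - {m}"
  then obtain i where "r < i" "A i (cyc_pred shift_cols j) = 1" using shift_in(3)[of j] by blast
  then have "delta n A i j = 1" by (simp add: delta_below)
  moreover have "m < j" using j shift_cols_bounds[of j] by auto
  ultimately show "j \<in> right_cols_below (delta n A) r m" using \<open>r < i\<close> by (auto simp: right_cols_below_def)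
qed

lemma Eval_eq_card:
  assumes "positive n A"
  shows "Eval n A = int (card {j \<in> {m<..n}. \<exists>i\<in>{k<..<r}. A i j = 1})"
proof -
  have "cell_sum A {k<..<r} {m<..n} = int (card {j \<in> {m<..n}. \<exists>i\<in>{k<..<r}. A i j = 1})"
  proof (rule cell_sum_eq_card)
    show "A i j = 0 \<or> A i j = 1" if "i \<in> {k<..<r}" for i j using that by (intro nonneg) auto
    show "i = i'" if "j \<in> {m<..n}" "A i j = 1" "A i' j = 1" for i i' j using that col_unique[of j i i'] by auto
  qed auto
  then show ?thesis using assms by (simp add: Eval_def frame_eqs)
qed

text \<open>Positivity places the 1 of the lowest enclosed row in the charged cell. This separates
  positive matrices from the neutral target, whose charge is 0.\<close>

lemma Eval_pos:
  assumes "positive n A"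
  shows "0 < Eval n A"
proof -
  let ?j = "one_col A (r - 1)"
  have r: "Suc k < r" "m < ?j" using assms by (auto simp: positive_def frame_eqs)
  then have "A (r - 1) ?j = 1" using bounds by (intro one_col_one) auto
  moreover from this have "?j \<le> n" using support[of "r - 1" ?j] by simp
  moreover have "r - 1 \<in> {k<..<r}" using r by auto
  ultimately have "?j \<in> {j \<in> {m<..n}. \<exists>i\<in>{k<..<r}. A i j = 1}" using r(2) by auto
  then have "card {j \<in> {m<..n}. \<exists>i\<in>{k<..<r}. A i j = 1} \<noteq> 0"
    by (subst card_0_eq) auto
  then show ?thesis unfolding Eval_eq_card[OF assms] by linarith
qed

text \<open>The cycle without \<open>m\<close> provides \<open>cval n A + 1\<close> columns, and
  \<open>?X\<close> provides one column for each 1 of the charged cell. A row of the charged cell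
  lands below row \<open>Suc k\<close>, because that row is occupied by a left row. The families are
  disjoint, as the columns of the cycle other than \<open>m\<close> have their 1 of \<open>A\<close>
  in the closing row or below. Strictness comes from the column \<open>c\<close>, which
  \<open>cval\<close> does not count.\<close>

lemma card_right_cols_below_delta:
  assumes "positive n A"
  shows "cval n A + Eval n A < int (card (right_cols_below (delta n A) (Suc k) m))"
proof -
  let ?X = "{j \<in> {m<..n}. \<exists>i\<in>{k<..<r}. A i j = 1}"
  let ?D = "right_cols_below (delta n A) (Suc k) m"
  have fin: "finite ?D" by (rule finite_right_cols_below[OF delta_perm])
  have "shift_cols - {m} \<subseteq> ?D"
  proof
    fix j assume "j \<in> shift_cols - {m}"
    then obtain i where "m < j" "r < i" "delta n A i j = 1"
      using shift_cols_subset by (auto simp: right_cols_below_def)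
    then show "j \<in> ?D" using bounds by (auto simp: right_cols_below_def intro!: exI[of _ i])
  qed
  moreover have "?X \<subseteq> ?D"
  proof
    fix j assume j: "j \<in> ?X"
    then obtain i where i: "i \<in> {k<..<r}" "A i j = 1" by blast
    obtain i' where i': "lowered_row i' = i" using bij_lowered_row by (metis bij_pointE)
    have "i' \<in> {k<..r}" using i' i lowered_row_out[of i'] by (cases "i' \<in> {k<..r}") auto
    moreover have P: "delta n A i' j = 1" using i i' by (simp add: delta_eq shifted_eq_one)
    moreover have "i' \<noteq> Suc k"
    proof
      assume "i' = Suc k"
      moreover obtain j' where "j' < m" "delta n A (Suc k) j' = 1" using delta_leading by blast
      ultimately have "j = j'" using perm_matD(5)[OF delta_perm, of i' j j'] P by simp
      then show False using j \<open>j' < m\<close> by simp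
    qed
    ultimately have "Suc k < i'" by auto
    then show "j \<in> ?D" using P j by (auto simp: right_cols_below_def)
  qed
  moreover have "(shift_cols - {m}) \<inter> ?X = {}"
  proof -
    have False if j: "j \<in> shift_cols" "j \<in> ?X" for j
    proof -
      obtain i where i: "i < r" "A i j = 1" "m < j" using j(2) by auto
      obtain i' where "r \<le> i'" "A i' j = 1"
        using below_closing_iff[of j] j(1) ones(2) by (cases "j = c") (auto intro: less_imp_le)
      then show False using col_unique[of j i i'] i by simp
    qed
    then show ?thesis by blast
  qed
  ultimately have "card (shift_cols - {m}) + card ?X \<le> card ?D"
    using card_mono[OF fin, of "(shift_cols - {m}) \<union> ?X"] finite_shift_cols
    by (simp add: card_Un_disjoint)
  moreover have "card (shift_cols - {m}) = Suc (card (shift_cols - {m, c}))"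
  proof -
    have "shift_cols - {m} = insert c (shift_cols - {m, c})" using m_c_in_shift_cols bounds by auto
    then show ?thesis using finite_shift_cols by simp
  qed
  ultimately show ?thesis unfolding cval_eq_card Eval_eq_card[OF assms] by linarith
qed

end

section \<open>Rebuilding a neutral matrix from its discharge\<close>

context neutral_asm_at
begin

lemma not_positive: "\<not> positive n A"
  by (simp add: positive_def frame_eqs neutral)

lemma Eval_zero: "Eval n A = 0"
  by (simp add: Eval_def not_positive)

lemma posneut: "posneut n A"
  using is_asm1 by (simp add: posneut_def neutral_def frame_eqs neutral)

text \<open>The closing row is the only row below the opening row that could move:
  \<open>Vdisp\<close> raises its left part by one row and lowering brings it back.\<close>

lemma delta_neutral: "delta n A = shifted"
proof -
  have "lowered_row i = i" for i
  proof (cases "i \<in> {k<..r}")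
    case True
    then have "i = r" using neutral by auto
    moreover have "lowered_row i = r" using lowered_row_in[OF True] neutral by auto
    ultimately show ?thesis by simp
  qed (rule lowered_row_out)
  then show ?thesis by (simp add: delta_eq)
qed

text \<open>Describes the cycle by the discharge, \<open>r\<close>, \<open>m\<close> and
  \<open>c\<close> alone, so that it can be inverted without knowing the matrix.\<close>

lemma shift_cols_eq: "shift_cols = insert m {j \<in> right_cols_below (delta n A) r m. j \<le> c}"
proof (intro equalityI subsetI)
  fix j assume "j \<in> shift_cols"
  then show "j \<in> insert m {j \<in> right_cols_below (delta n A) r m. j \<le> c}"
    using shift_cols_subset shift_cols_bounds by blast
next
  fix j assume j: "j \<in> insert m {j \<in> right_cols_below (delta n A) r m. j \<le> c}"
  show "j \<in> shift_cols"
  proof (rule ccontr)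
    assume n: "j \<notin> shift_cols"
    then have "j \<noteq> m" "j \<noteq> c" using m_c_in_shift_cols by auto
    then obtain i where i: "m < j" "j \<le> c" "r < i" "delta n A i j = 1"
      using j by (auto simp: right_cols_below_def)
    then have "A i j = 1" using delta_below cyc_pred_not_in[OF n] by simp
    then show False using below_closing_iff[OF \<open>j \<noteq> c\<close>] n i by auto
  qed
qed

text \<open>Each candidate before \<open>c\<close> is a column of the cycle strictly between
  \<open>m\<close> and \<open>c\<close>, so \<open>cval\<close> is the rank of the closing column
  among the candidates.\<close>

lemma cval_eq_rank: "cval n A = int (card {j \<in> right_cols_below (delta n A) r m. j < c})"
proof -
  have "shift_cols - {m, c} = {j \<in> right_cols_below (delta n A) r m. j < c}"
    unfolding shift_cols_eq by (auto simp: right_cols_below_def)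
  then show ?thesis by (simp add: cval_eq_card)
qed

lemma closing_col_right_below: "c \<in> right_cols_below (delta n A) r m"
  using shift_cols_subset m_c_in_shift_cols bounds by auto

end

lemma neutral_determined:
  assumes "neutral_asm_at n A k r u l m c" "neutral_asm_at n A' k r' u' l' m' c'"
    and d: "delta n A = delta n A'" and cv: "cval n A = cval n A'"
  shows "A = A'"
proof -
  interpret N: neutral_asm_at n A k r u l m c by fact
  interpret N': neutral_asm_at n A' k r' u' l' m' c' by fact
  have r: "r' = r" using N.neutral N'.neutral by simp
  \<comment> \<open>Discharging leaves the 1 of the opening row in place, so the discharge shows the
    opening column in row \<open>k\<close>.\<close>
  have m: "m' = m" using perm_matD(5)[OF N.delta_perm N.delta_opening] N'.delta_opening d by simp
  let ?D = "right_cols_below (delta n A) r m"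
  have c: "c' = c"
  proof (rule rank_unique[OF finite_right_cols_below[OF N.delta_perm]])
    show "c \<in> ?D" by (rule N.closing_col_right_below)
    show "c' \<in> ?D" using N'.closing_col_right_below by (simp add: r m d)
    show "card {j \<in> ?D. j < c'} = card {j \<in> ?D. j < c}"
      using N.cval_eq_rank N'.cval_eq_rank cv by (simp add: r m d)
  qed
  have S: "N'.shift_cols = N.shift_cols"
    unfolding N.shift_cols_eq N'.shift_cols_eq by (simp add: r m c d)
  have sh: "N.shifted i j = N'.shifted i j" for i j using d N.delta_neutral N'.delta_neutral by simp
  show ?thesis
  proof (intro ext)
    fix i j
    consider "r < i" | "(i, j) = (r, m)" | "(i, j) = (r, c)" | "i \<le> r" "(i, j) \<noteq> (r, m)" "(i, j) \<noteq> (r, c)"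
      by fastforce
    then show "A i j = A' i j"
    proof cases
      case 1
      \<comment> \<open>Below the closing row column \<open>j\<close> of either matrix reappears in
        the discharge as the column \<open>j'\<close> following it in the common cycle.\<close>
      obtain j' where "cyc_pred N.shift_cols j' = j" using N.bij_shift by (metis bij_pointE)
      then show ?thesis using sh[of i j'] 1
        unfolding N.shifted_def N'.shifted_def S unfolding r by simp
    next
      case 2
      then show ?thesis using N.neg N'.neg r m by simp
    next
      case 3
      then show ?thesis using N.ones N'.ones r c by simp
    next
      case 4
      then show ?thesis using sh[of i j]
        unfolding N.shifted_def N'.shifted_def unfolding r m c by auto
    qed
  qed
qed

lemma neutral_exists:
  assumes P: "perm_mat n P" and k: "P k m = 1" and l: "P (Suc k) l = 1" "l < m"
    and c: "c \<in> right_cols_below P (Suc k) m"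
  obtains N u where "neutral_asm_at n N k (Suc k) u l m c" "delta n N = P"
proof -
  let ?r = "Suc k"
  let ?D = "right_cols_below P ?r m"
  define S where "S = insert m {j \<in> ?D. j \<le> c}"
  define f where "f = cyc_pred S"
  define g where "g = inv f"
  \<comment> \<open>Inverse of steps (2) and (1): the lower columns go back along the cycle, then
    the closing 1 and the -1 are restored. Steps (3) and (4) are trivial on neutral matrices by
    \<open>delta_neutral\<close>.\<close>
  define N where "N i j = (if ?r < i then P i (g j) else if (i, j) = (?r, m) then -1
     else if (i, j) = (?r, c) then 1 else P i j)" for i j
  note D = perm_matD[OF P]
  have mc: "m < c" using c by (simp add: right_cols_below_def)
  have finS: "finite S" using finite_right_cols_below[OF P] by (simp add: S_def)
  have bij: "bij f" unfolding f_def by (rule bij_cyc_pred[OF finS])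
  have fg: "f (g j) = j" for j unfolding g_def using bij by (simp add: bij_is_surj surj_f_inv_f)
  have gf: "g (f j) = j" for j unfolding g_def using bij by (simp add: bij_is_inj)
  have S_bounds: "m \<le> j \<and> j \<le> c" if "j \<in> S" for j using that mc by (auto simp: S_def right_cols_below_def)
  have mS: "m \<in> S" "c \<in> S" using c mc by (auto simp: S_def)
  have MM: "Min S = m" "Max S = c" using finS mS S_bounds by (auto intro!: Min_eqI Max_eqI)
  have fm: "f m = c" using mS by (simp add: f_def cyc_pred_def MM)
  have gc: "g c = m" using gf[of m] fm by simp
  have g_out: "g j = j" if "j \<notin> S" for j using gf[of j] cyc_pred_not_in[OF that] by (simp add: f_def)
  have g_in: "g j \<in> S" if "j \<in> S" for j using fg[of j] cyc_pred_not_in[of "g j" S] that by (metis f_def)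
  have g_D: "g j \<in> ?D" if "j \<in> S" "j \<noteq> c" for j
    using g_in[OF that(1)] fg[of j] fm that(2) by (auto simp: S_def)
  have D_row: "i > ?r" if j: "j \<in> ?D" "P i j = 1" for i j
  proof -
    obtain i' where "?r < i'" "P i' j = 1" using j(1) by (auto simp: right_cols_below_def)
    then show ?thesis using D(6)[of i j i'] j(2) by simp
  qed
  have rng: "k \<in> {1..n}" "m \<in> {1..n}" "?r \<in> {1..n}" "l \<in> {1..n}"
    using D(2)[of k m] D(2)[of ?r l] k l by auto
  have cn: "c \<in> {1..n}"
  proof -
    obtain i where "P i c = 1" using c by (auto simp: right_cols_below_def)
    then show ?thesis using D(2)[of i c] by auto
  qed
  \<comment> \<open>Column \<open>m\<close> of \<open>N\<close> is refilled below the closing row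
    from its successor in the cycle, which is a candidate column and hence has a 1 there: the lower
    1 of the opening column.\<close>
  obtain u where u: "?r < u" "P u (g m) = 1" using g_D[OF mS(1)] mc by (auto simp: right_cols_below_def)
  have un: "u \<le> n" using D(2)[of u "g m"] u by auto
  have N_at: "neutral_asm_at n N k ?r u l m c"
  proof
    show "1 \<le> k" "k < ?r" "?r < u" "u \<le> n" "1 \<le> l" "l < m" "m < c" "c \<le> n" "?r = Suc k"
      using rng u un l mc cn by auto
    show "N ?r m = - 1" by (simp add: N_def)
    show "N i j = 0 \<or> N i j = 1" if "(i, j) \<noteq> (?r, m)" for i j
      using that D(1)[of i "g j"] D(1)[of i j] unfolding N_def by presburger
    show "i \<in> {1..n} \<and> j \<in> {1..n}" if nz: "N i j \<noteq> 0" for i j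
    proof (cases "?r < i")
      case True
      then have P: "P i (g j) \<noteq> 0" using nz by (simp add: N_def)
      show ?thesis
      proof (cases "j \<in> S")
        case True
        then show ?thesis using D(2)[OF P] S_bounds[OF True] rng cn by auto
      next
        case False
        then show ?thesis using D(2)[OF P] by (simp add: g_out)
      qed
    next
      case False
      then have "(i, j) = (?r, m) \<or> (i, j) = (?r, c) \<or> P i j \<noteq> 0" using nz unfolding N_def by presburger
      then show ?thesis using D(2)[of i j] rng cn by auto
    qed
    show "N ?r j = 1 \<longleftrightarrow> j = l \<or> j = c" for j
      using D(5)[OF l(1), of j] l mc by (auto simp: N_def)
    show "N i m = 1 \<longleftrightarrow> i = k \<or> i = u" for i
    proof -
      consider "?r < i" | "i = ?r" | "i < ?r" by linarith
      then show ?thesis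
      proof cases
        case 1
        then have "N i m = 1 \<longleftrightarrow> i = u" using D(6)[of i "g m" u] u by (auto simp: N_def)
        then show ?thesis using 1 by auto
      next
        case 2
        then show ?thesis using u by (simp add: N_def)
      next
        case 3
        then have "N i m = 1 \<longleftrightarrow> i = k" using D(6)[of i m k] k by (auto simp: N_def)
        then show ?thesis using 3 u by auto
      qed
    qed
    show "\<exists>!j. N i j = 1" if i: "i \<in> {1..n}" "i \<noteq> ?r" for i
    proof (cases "?r < i")
      case True
      have "bij g" using bij bij_imp_bij_inv by (simp add: g_def)
      then have "\<exists>!j. P i (g j) = 1" using iffD2[OF ex1_bij[of g "\<lambda>j. P i j = 1"] D(3)[OF i(1)]] by simp
      then show ?thesis using True by (simp add: N_def)
    next
      case False
      then show ?thesis using D(3)[OF i(1)] i(2) by (simp add: N_def)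
    qed
    show "\<exists>!i. N i j = 1" if j: "j \<in> {1..n}" "j \<noteq> m" for j
    proof -
      consider "j \<notin> S" | "j = c" | "j \<in> S" "j \<noteq> c" by blast
      then show ?thesis
      proof cases
        case 1
        then have "N i j = P i j" for i using j(2) mS by (auto simp: N_def g_out)
        then show ?thesis using D(4)[OF j(1)] by simp
      next
        case 2
        have "N i c = 1 \<longleftrightarrow> i = ?r" for i
        proof -
          consider "?r < i" | "i = ?r" | "i < ?r" by linarith
          then show ?thesis
          proof cases
            case 1
            \<comment> \<open>Column \<open>c\<close> of \<open>N\<close> takes the lower part of
              column \<open>m\<close> of \<open>P\<close>, which is empty because the 1 of that
              column is in row \<open>k\<close>.\<close>
            then have "P i m \<noteq> 1" using D(6)[of i m k] k by auto
            then show ?thesis using 1 by (simp add: N_def gc)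
          next
            case 2
            then show ?thesis using mc by (simp add: N_def)
          next
            case 3
            then have "P i c \<noteq> 1" using D_row[OF c, of i] by auto
            then show ?thesis using 3 by (simp add: N_def)
          qed
        qed
        then show ?thesis by (simp add: 2)
      next
        case 3
        have jD: "j \<in> ?D" using 3 j(2) by (auto simp: S_def)
        have gD: "g j \<in> ?D" by (rule g_D[OF 3])
        then obtain i where i: "?r < i" "P i (g j) = 1" by (auto simp: right_cols_below_def)
        have "N i' j = 1 \<longleftrightarrow> i' = i" for i'
        proof (cases "?r < i'")
          case True
          then show ?thesis using D(6)[of i' "g j" i] i by (auto simp: N_def)
        next
          case False
          then have "P i' j \<noteq> 1" using D_row[OF jD, of i'] by auto
          then show ?thesis using False i 3 j(2) by (auto simp: N_def)
        qed
        then show ?thesis by simp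
      qed
    qed
  qed
  interpret N: neutral_asm_at n N k ?r u l m c by (rule N_at)
  \<comment> \<open>Discharging \<open>N\<close> uses the cycle computed from \<open>N\<close>; it
    undoes the construction only if this is the cycle computed from \<open>P\<close>.\<close>
  have S: "N.shift_cols = S"
  proof (intro equalityI subsetI)
    fix j assume j: "j \<in> N.shift_cols"
    show "j \<in> S"
    proof (rule ccontr)
      assume nS: "j \<notin> S"
      then have "j \<noteq> c" "j \<noteq> m" using mS by auto
      then obtain i where i: "m < j" "j \<le> c" "?r < i" "N i j = 1" using N.below_closing_iff[of j] j by auto
      then have "P i j = 1" by (simp add: N_def g_out[OF nS])
      then have "j \<in> S" using i by (auto simp: S_def right_cols_below_def)
      then show False using nS by simp
    qed
  next
    fix j assume j: "j \<in> S"
    show "j \<in> N.shift_cols"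
    proof (cases "j = c")
      case True
      then show ?thesis using N.m_c_in_shift_cols by simp
    next
      case False
      then obtain i where "?r < i" "P i (g j) = 1" using g_D[OF j False] by (auto simp: right_cols_below_def)
      then have "?r < i \<and> N i j = 1" by (simp add: N_def)
      then show ?thesis using N.below_closing_iff[OF False] S_bounds[OF j] by auto
    qed
  qed
  have "N.shifted i j = P i j" for i j
  proof (cases "?r < i")
    case True
    then show ?thesis by (simp add: N.shifted_def S N_def gf f_def[symmetric])
  next
    case False
    \<comment> \<open>The two entries overwritten in the closing row were zero in \<open>P\<close>,
      since the 1 of that row is in column \<open>l\<close>; erasing them therefore gives
      \<open>P\<close> back.\<close>
    have "P ?r m = 0" "P ?r c = 0" using D(1)[of ?r m] D(1)[of ?r c] D(5)[OF l(1), of m] D(5)[OF l(1), of c] l mc by auto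
    then show ?thesis using False by (auto simp: N.shifted_def N_def)
  qed
  then have "delta n N = P" by (simp add: N.delta_neutral fun_eq_iff)
  then show thesis using that N_at by blast
qed

section \<open>Evaluating the neutralizing procedure\<close>

text \<open>A competitor has charge 0, so \<open>Eval_pos\<close> makes it neutral and
  \<open>neutral_determined\<close> applies. The lemma serves positive \<open>A\<close> as well as
  neutral \<open>A\<close>, where \<open>N\<close> is \<open>A\<close> itself.\<close>

lemma Lambda_pn_neutral:
  assumes "neutral_asm_at n N k r u l m c" "delta n N = delta n A" "opening_row n A = k"
    "cval n N = cval n A + Eval n A"
  shows "Lambda_pn n A = (N, Eval n A)"
proof -
  interpret N: neutral_asm_at n N k r u l m c by fact
  have "(THE N. posneut n N \<and> Delta n N = (opening_row n A, delta n A, cval n A + Eval n A, 0)) = N"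
  proof (rule the_equality)
    show "posneut n N \<and> Delta n N = (opening_row n A, delta n A, cval n A + Eval n A, 0)"
      using N.posneut assms by (simp add: Delta_def N.Eval_zero N.frame_eqs)
  next
    fix N' assume N': "posneut n N' \<and> Delta n N' = (opening_row n A, delta n A, cval n A + Eval n A, 0)"
    then obtain k' r' u' l' m' c' where "asm_at n N' k' r' u' l' m' c'"
      unfolding posneut_def using asm1_imp_asm_at by blast
    then interpret N': asm_at n N' k' r' u' l' m' c' .
    have "\<not> positive n N'" using N'.Eval_pos N' by (auto simp: Delta_def)
    then have "r' = Suc k'" using N' by (simp add: posneut_def neutral_def N'.frame_eqs)
    moreover have "k' = k" using N' assms(3) by (simp add: Delta_def N'.frame_eqs)
    ultimately have "neutral_asm_at n N' k r' u' l' m' c'"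
      using N'.asm_at_axioms by (simp add: neutral_asm_at_def neutral_asm_at_axioms_def)
    then show "N' = N"
      using assms N' by (intro neutral_determined[of n N' k _ _ _ _ _ N]) (auto simp: Delta_def)
  qed
  then show ?thesis by (simp add: Lambda_pn_def)
qed

lemma Lambda_pn_positive:
  assumes "asm_at n A k r u l m c" "positive n A"
  obtains N u' l' c' where "neutral_asm_at n N k (Suc k) u' l' m c'"
    "Lambda_pn n A = (N, Eval n A)" "0 \<le> Eval n A" "Eval n A \<le> cval n N"
proof -
  interpret A: asm_at n A k r u l m c by fact
  let ?D = "right_cols_below (delta n A) (Suc k) m"
  have cv: "0 \<le> cval n A" by (simp add: A.cval_eq_card)
  have ev: "0 < Eval n A" by (rule A.Eval_pos[OF assms(2)])
  have "nat (cval n A + Eval n A) < card ?D"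
    using A.card_right_cols_below_delta[OF assms(2)] cv ev by linarith
  then obtain c' where c': "c' \<in> ?D" "card {j \<in> ?D. j < c'} = nat (cval n A + Eval n A)"
    using exists_rank[OF finite_right_cols_below[OF A.delta_perm]] by metis
  obtain l' where l': "l' < m" "delta n A (Suc k) l' = 1" using A.delta_leading by blast
  obtain N u' where N: "neutral_asm_at n N k (Suc k) u' l' m c'" "delta n N = delta n A"
    using neutral_exists[OF A.delta_perm A.delta_opening l'(2,1) c'(1)] by blast
  interpret N: neutral_asm_at n N k "Suc k" u' l' m c' by (rule N(1))
  have cN: "cval n N = cval n A + Eval n A" using N.cval_eq_rank c'(2) cv ev by (simp add: N(2))
  show thesis
  proof (rule that[OF N(1)])
    show "Lambda_pn n A = (N, Eval n A)"
      by (rule Lambda_pn_neutral[OF N(1) N(2) A.opening_row_eq cN])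
    show "0 \<le> Eval n A" "Eval n A \<le> cval n N" using ev cv cN by auto
  qed
qed

lemma (in asm_at) sign_cases:
  obtains "r = Suc k" | "positive n A" "\<not> negative n A" | "negative n A"
proof (cases "r = Suc k")
  case False
  then have r: "Suc k < r" using bounds by simp
  then have "A (r - 1) (one_col A (r - 1)) = 1" using bounds by (intro one_col_one) auto
  then have "one_col A (r - 1) \<noteq> m" using opening_col_ones[of "r - 1"] r bounds by auto
  then consider "m < one_col A (r - 1)" | "one_col A (r - 1) < m" by linarith
  then show thesis
    by cases (use r that in \<open>auto simp: positive_def negative_def frame_eqs\<close>)
qed (use that in blast)

lemma (in asm_at) negative_reflect: "negative n (reflect n A) \<longleftrightarrow> positive n A"
proof (cases "Suc k < r")
  case True
  interpret R: asm_at n "reflect n A" k r u "n + 1 - c" "n + 1 - m" "n + 1 - l" by (rule reflect_asm_at)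
  have "r - 1 \<in> {1..n}" "r - 1 \<noteq> r" using True bounds by auto
  note one = one_col_one[OF this]
  have j: "one_col A (r - 1) \<in> {1..n}" using support one by (metis zero_neq_one)
  have "reflect n A (r - 1) (n + 1 - one_col A (r - 1)) = 1" using one j by (simp only: reflect_flip)
  then have "one_col (reflect n A) (r - 1) = n + 1 - one_col A (r - 1)"
    using R.one_col_eq[OF \<open>r - 1 \<noteq> r\<close>] by blast
  moreover have "n + 1 - one_col A (r - 1) < n + 1 - m \<longleftrightarrow> m < one_col A (r - 1)" using j bounds by auto
  ultimately show ?thesis by (simp only: positive_def negative_def frame_eqs R.frame_eqs)
next
  case False
  interpret R: asm_at n "reflect n A" k r u "n + 1 - c" "n + 1 - m" "n + 1 - l" by (rule reflect_asm_at)
  show ?thesis using False by (simp add: positive_def negative_def frame_eqs R.frame_eqs)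
qed

theorem theorem5:
  fixes n :: nat and A :: mat
  assumes "asm1 n A"
  shows "dual n (Phi n (Lambda n A)) = Phi n (Lambda n (reflect n A))"
proof -
  obtain k r u l m c where "asm_at n A k r u l m c" using asm1_imp_asm_at[OF assms] .
  then interpret A: asm_at n A k r u l m c .
  interpret R: asm_at n "reflect n A" k r u "n + 1 - c" "n + 1 - m" "n + 1 - l" by (rule A.reflect_asm_at)
  show ?thesis
  proof (cases rule: A.sign_cases)
    case 1
    then have N: "neutral_asm_at n A k r u l m c" by unfold_locales
    then interpret A: neutral_asm_at n A k r u l m c .
    note NR = A.reflect_neutral_asm_at
    interpret R: neutral_asm_at n "reflect n A" k r u "n + 1 - c" "n + 1 - m" "n + 1 - l" by (rule NR)
    \<comment> \<open>A neutral matrix has charge 0 and is therefore its own neutral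
      partner.\<close>
    have "Lambda n A = (A, 0)"
      using Lambda_pn_neutral[OF N refl A.opening_row_eq] 1
      by (simp add: Lambda_def negative_def A.frame_eqs A.Eval_zero)
    moreover have "Lambda n (reflect n A) = (reflect n A, 0)"
      using Lambda_pn_neutral[OF NR refl R.opening_row_eq] 1
      by (simp add: Lambda_def negative_def R.frame_eqs R.Eval_zero)
    ultimately show ?thesis
      using dual_neutral[OF N, of 0] A.ell_nonneg A.cval_nonneg by simp
  next
    case 2
    obtain N u' l' c' where N: "neutral_asm_at n N k (Suc k) u' l' m c'"
      "Lambda_pn n A = (N, Eval n A)" "0 \<le> Eval n A" "Eval n A \<le> cval n N"
      using Lambda_pn_positive[OF A.asm_at_axioms 2(1)] .
    interpret N: neutral_asm_at n N k "Suc k" u' l' m c' by (rule N(1))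
    have "Lambda n A = (N, Eval n A)" using 2 N(2) by (simp add: Lambda_def)
    moreover have "Lambda n (reflect n A) = (reflect n N, - Eval n A)"
      using A.negative_reflect 2(1) N(2) by (simp add: Lambda_def A.reflect_reflect)
    ultimately show ?thesis
      using dual_neutral[OF N(1), of "Eval n A"] N(3,4) N.ell_nonneg by simp
  next
    case 3
    let ?E = "Eval n (reflect n A)"
    have pos: "positive n (reflect n A)"
      using R.negative_reflect 3 by (simp add: A.reflect_reflect)
    obtain N u' l' c' where N: "neutral_asm_at n N k (Suc k) u' l' (n + 1 - m) c'"
      "Lambda_pn n (reflect n A) = (N, ?E)" "0 \<le> ?E" "?E \<le> cval n N"
      using Lambda_pn_positive[OF R.asm_at_axioms pos] .
    interpret N: neutral_asm_at n N k "Suc k" u' l' "n + 1 - m" c' by (rule N(1))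
    have "Lambda n A = (reflect n N, - ?E)" using 3 N(2) by (simp add: Lambda_def)
    moreover have "\<not> negative n (reflect n A)" using pos by (auto simp: positive_def negative_def)
    then have "Lambda n (reflect n A) = (N, ?E)" using N(2) by (simp add: Lambda_def)
    \<comment> \<open>Duality is applied to the reflected partner with charge \<open>- ?E\<close>,
      so that involutivity is needed only for \<open>reflect\<close> and not for
      \<open>dual\<close>. Reflection swaps \<open>ell\<close> and \<open>cval\<close>, hence the
      lower bound on the charge is \<open>?E \<le> cval n N\<close>.\<close>
    moreover have "dual n (Phi n (reflect n N, - ?E)) = Phi n (reflect n (reflect n N), - (- ?E))"
      using N.ell_nonneg N(3,4)
      by (intro dual_neutral[OF N.reflect_neutral_asm_at]) (simp_all add: N.ell_reflect N.cval_reflect)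
    ultimately show ?thesis by (simp add: N.reflect_reflect)
  qed
qed

end
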